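(* Identify $E$ with the free group $\mathbb F_\infty$ via the free basis $x_k=a_1a_{k+1}$, $k\ge1$. Then $\mathcal C\mapsto F(\mathcal C)$ is a lattice isomorphism (inclusion-preserving bijection with inclusion-preserving inverse) from the set of simplifiable hyperoctahedral categories of partitions onto the set of proper $S$-invariant subgroups of $\mathbb F_\infty$.
   Context: A partition $p\in P(k,l)$ ($k,l\ge 0$) is a partition of the disjoint union of $k$ ordered upper points $1,\dots,k$ and $l$ ordered lower points $1',\dots,l'$ into nonempty disjoint subsets called blocks; $P=\bigcup_{k,l}P(k,l)$. Operations on partitions: the tensor product $p\otimes q$ (horizontal juxtaposition, $q$ placed to the right of $p$); the composition of $p\in P(k,l)$ with $q\in P(l,m)$ (stack $p$ on top of $q$, identify the lower points of $p$ with the upper points of $q$, merge blocks connected through these middle points, then erase the middle points and any block lying entirely among them), giving a partition in $P(k,m)$; the involution $p^*$ (reflection of $p$ upside down); and rotation (moving the leftmost, resp. rightmost, point of one row to the leftmost, resp. rightmost, position of the other row, keeping the blocks). A category of partitions is a subset $\mathcal C\subseteq P$ containing the pair partition $\sqcap\in P(0,2)$ (one block consisting of two lower points) and the identity partition $|\in P(1,1)$ (one block $\{1,1'\}$), and closed under these four operations. Special partitions: the four block $b_4\in P(0,4)$ (one block of four lower points); the double singleton $\uparrow\otimes\uparrow\in P(0,2)$ (two one-point blocks); the pair positioner $\rho\in P(3,3)$ with blocks $\{1,2,2',3'\}$ and $\{3,1'\}$. A category of partitions $\mathcal C$ is hyperoctahedral if $b_4\in\mathcal C$ and $\uparrow\otimes\uparrow\notin\mathcal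 C$; it is simplifiable hyperoctahedral if moreover $\rho\in\mathcal C$. Let $L=\{a_1,a_2,\dots\}$, $\mathbb F_L$ the free group on $L$, $G=\mathbb Z_2^{*\infty}$ the free product of countably many copies of $\mathbb Z/2\mathbb Z$ generated by $a_1,a_2,\dots$ with $a_i^2=e$, and $\pi:\mathbb F_L\to G$ the canonical surjection. A labelling $\ell$ of a partition $p$ assigns pairwise distinct letters of $L$ to the blocks of $p$; $w(p,\ell)\in\mathbb F_L$ is the word obtained by reading the labels of the points of $p$ starting at the leftmost upper point, going through the upper row from left to right and then through the lower row from right to left. For a category $\mathcal C$, $F(\mathcal C)=\{\pi(w(p,\ell)) : p\in\mathcal C,\ \ell\text{ a labelling of }p\}$. $E\le G$ is the subgroup of elements of even length; it is free on $x_k=a_1a_{k+1}$, $k\ge 1$. $S\subseteq\mathrm{End}(\mathbb F_\infty)$ (with free basis $x_1,x_2,\dots$) is the subsemigroup generated by: (i) for every $n$ and indices $i(1),\dots,i(n)$, the endomorphism $x_k\mapsto x_{i(k)}$ ($k\le n$), $x_k\mapsto x_k$ ($k>n$); (ii) for every $i$, the endomorphism $x_k\mapsto x_i^{-1}x_k$ for all $k$; (iii) for every $k$, the endomorphism $x_k\mapsto e$ fixing all other $x_j$; (iv) the endomorphism $x_k\mapsto x_k^{-1}$ for all $k$; (v) all inner automorphisms. A subgroup $H$ is $S$-invariant if $\phi(H)\subseteq H$ for all $\phi\in S$. *)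

theory Defs
  imports "HOL-Algebra.Group"
begin

section \<open>Partitions\<close>

text \<open>Points of a partition in P(k,l): upper points Up 0..Up (k-1) (the paper's 1..k),
  lower points Lo 0..Lo (l-1) (the paper's 1'..l').  A partition is a triple (k,l,B)
  where B is the set of blocks.\<close>

datatype pt = Up nat | Lo nat

type_synonym partition = "nat \<times> nat \<times> pt set set"

definition pp_points :: "nat \<Rightarrow> nat \<Rightarrow> pt set" where
  "pp_points k l = {Up i | i. i < k} \<union> {Lo j | j. j < l}"

definition pp_valid :: "partition \<Rightarrow> bool" where
  "pp_valid p = (case p of (k, l, B) \<Rightarrow>
      (\<forall>b\<in>B. b \<noteq> {}) \<and> \<Union>B = pp_points k l \<and>
      (\<forall>b\<in>B. \<forall>c\<in>B. b \<noteq> c \<longrightarrow> b \<inter> c = {}))"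

definition pp_upper :: "partition \<Rightarrow> nat" where "pp_upper p = fst p"
definition pp_lower :: "partition \<Rightarrow> nat" where "pp_lower p = fst (snd p)"
definition pp_blocks :: "partition \<Rightarrow> pt set set" where "pp_blocks p = snd (snd p)"

text \<open>Tensor product: q placed to the right of p.\<close>
fun pp_shift :: "nat \<Rightarrow> nat \<Rightarrow> pt \<Rightarrow> pt" where
  "pp_shift k l (Up i) = Up (i + k)"
| "pp_shift k l (Lo j) = Lo (j + l)"

definition pp_tensor :: "partition \<Rightarrow> partition \<Rightarrow> partition" where
  "pp_tensor p q = (case p of (k1, l1, B1) \<Rightarrow> case q of (k2, l2, B2) \<Rightarrow>
      (k1 + k2, l1 + l2, B1 \<union> (\<lambda>b. pp_shift k1 l1 ` b) ` B2))"

text \<open>Involution: reflection upside down.\<close>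
fun pp_flip :: "pt \<Rightarrow> pt" where
  "pp_flip (Up i) = Lo i"
| "pp_flip (Lo j) = Up j"

definition pp_star :: "partition \<Rightarrow> partition" where
  "pp_star p = (case p of (k, l, B) \<Rightarrow> (l, k, (\<lambda>b. pp_flip ` b) ` B))"

text \<open>Composition of p in P(k,l) (on top) with q in P(l,m) (below).  Points of the
  stacked picture are encoded as (0,i) (upper row of p), (1,j) (middle row), (2,i)
  (lower row of q).\<close>
fun pp_top :: "pt \<Rightarrow> nat \<times> nat" where
  "pp_top (Up i) = (0, i)"
| "pp_top (Lo j) = (1, j)"

fun pp_bot :: "pt \<Rightarrow> nat \<times> nat" where
  "pp_bot (Up j) = (1, j)"
| "pp_bot (Lo i) = (2, i)"

fun pp_back :: "nat \<times> nat \<Rightarrow> pt" where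
  "pp_back (a, i) = (if a = 0 then Up i else Lo i)"

definition pp_comp :: "partition \<Rightarrow> partition \<Rightarrow> partition" where
  "pp_comp p q = (case p of (k, l, B1) \<Rightarrow> case q of (l', m, B2) \<Rightarrow>
     (let conn = {(x, y). \<exists>b \<in> (\<lambda>b. pp_top ` b) ` B1 \<union> (\<lambda>b. pp_bot ` b) ` B2.
                              x \<in> b \<and> y \<in> b};
          R = conn\<^sup>*;
          outer = {(0, i) | i. i < k} \<union> {(2, i) | i. i < m}
      in (k, m, {pp_back ` ({y. (x, y) \<in> R} \<inter> outer) | x. x \<in> outer})))"

text \<open>Rotations.\<close>
fun pp_rotUL_map :: "pt \<Rightarrow> pt" where
  "pp_rotUL_map (Up i) = (if i = 0 then Lo 0 else Up (i - 1))"
| "pp_rotUL_map (Lo j) = Lo (Suc j)"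

fun pp_rotLU_map :: "pt \<Rightarrow> pt" where
  "pp_rotLU_map (Lo j) = (if j = 0 then Up 0 else Lo (j - 1))"
| "pp_rotLU_map (Up i) = Up (Suc i)"

fun pp_rotUR_map :: "nat \<Rightarrow> nat \<Rightarrow> pt \<Rightarrow> pt" where
  "pp_rotUR_map k l (Up i) = (if i = k - 1 then Lo l else Up i)"
| "pp_rotUR_map k l (Lo j) = Lo j"

fun pp_rotLR_map :: "nat \<Rightarrow> nat \<Rightarrow> pt \<Rightarrow> pt" where
  "pp_rotLR_map k l (Lo j) = (if j = l - 1 then Up k else Lo j)"
| "pp_rotLR_map k l (Up i) = Up i"

text \<open>leftmost upper point to leftmost lower position (needs k \<ge> 1)\<close>
definition pp_rotUL :: "partition \<Rightarrow> partition" where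
  "pp_rotUL p = (case p of (k, l, B) \<Rightarrow> (k - 1, Suc l, (\<lambda>b. pp_rotUL_map ` b) ` B))"
text \<open>leftmost lower point to leftmost upper position (needs l \<ge> 1)\<close>
definition pp_rotLU :: "partition \<Rightarrow> partition" where
  "pp_rotLU p = (case p of (k, l, B) \<Rightarrow> (Suc k, l - 1, (\<lambda>b. pp_rotLU_map ` b) ` B))"
text \<open>rightmost upper point to rightmost lower position (needs k \<ge> 1)\<close>
definition pp_rotUR :: "partition \<Rightarrow> partition" where
  "pp_rotUR p = (case p of (k, l, B) \<Rightarrow> (k - 1, Suc l, (\<lambda>b. pp_rotUR_map k l ` b) ` B))"
text \<open>rightmost lower point to rightmost upper position (needs l \<ge> 1)\<close>
definition pp_rotLR :: "partition \<Rightarrow> partition" where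
  "pp_rotLR p = (case p of (k, l, B) \<Rightarrow> (Suc k, l - 1, (\<lambda>b. pp_rotLR_map k l ` b) ` B))"

text \<open>Special partitions.\<close>
definition pp_pair :: partition where "pp_pair = (0, 2, {{Lo 0, Lo 1}})"
definition pp_id :: partition where "pp_id = (1, 1, {{Up 0, Lo 0}})"
definition pp_b4 :: partition where "pp_b4 = (0, 4, {{Lo 0, Lo 1, Lo 2, Lo 3}})"
definition pp_dsing :: partition where "pp_dsing = (0, 2, {{Lo 0}, {Lo 1}})"
text \<open>pair positioner: blocks {1,2,2',3'} and {3,1'}\<close>
definition pp_rho :: partition where
  "pp_rho = (3, 3, {{Up 0, Up 1, Lo 1, Lo 2}, {Up 2, Lo 0}})"

definition category_of_partitions :: "partition set \<Rightarrow> bool" where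
  "category_of_partitions C \<longleftrightarrow>
     (\<forall>p\<in>C. pp_valid p) \<and> pp_pair \<in> C \<and> pp_id \<in> C \<and>
     (\<forall>p\<in>C. \<forall>q\<in>C. pp_tensor p q \<in> C) \<and>
     (\<forall>p\<in>C. \<forall>q\<in>C. pp_lower p = pp_upper q \<longrightarrow> pp_comp p q \<in> C) \<and>
     (\<forall>p\<in>C. pp_star p \<in> C) \<and>
     (\<forall>p\<in>C. 1 \<le> pp_upper p \<longrightarrow> pp_rotUL p \<in> C \<and> pp_rotUR p \<in> C) \<and>
     (\<forall>p\<in>C. 1 \<le> pp_lower p \<longrightarrow> pp_rotLU p \<in> C \<and> pp_rotLR p \<in> C)"

definition hyperoctahedral :: "partition set \<Rightarrow> bool" where
  "hyperoctahedral C \<longleftrightarrow> category_of_partitions C \<and> pp_b4 \<in> C \<and> pp_dsing \<notin> C"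

definition simpl_hyperoctahedral :: "partition set \<Rightarrow> bool" where
  "simpl_hyperoctahedral C \<longleftrightarrow> hyperoctahedral C \<and> pp_rho \<in> C"

section \<open>The group G = Z_2^{*\<infinity>} and the map F\<close>

text \<open>Elements of G are reduced words in the generators a_i (i \<ge> 1), i.e. lists of
  positive naturals without two equal adjacent letters.  The canonical map from
  positive words of the free group F_L to G cancels adjacent equal letters.\<close>

definition z2_red :: "nat list \<Rightarrow> nat list" where
  "z2_red ws = foldr (\<lambda>a acc. case acc of [] \<Rightarrow> [a]
                                | b # r \<Rightarrow> (if a = b then r else a # acc)) ws []"

definition z2_reduced :: "nat list \<Rightarrow> bool" where
  "z2_reduced w \<longleftrightarrow> (\<forall>j. Suc j < length w \<longrightarrow> w ! j \<noteq> w ! Suc j)"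

definition G_carrier :: "nat list set" where
  "G_carrier = {w. z2_reduced w \<and> (\<forall>i\<in>set w. 1 \<le> i)}"

text \<open>E: the elements of even length.\<close>
definition E_carrier :: "nat list set" where
  "E_carrier = {w \<in> G_carrier. even (length w)}"

text \<open>A labelling assigns pairwise distinct letters a_i (i \<ge> 1) to the blocks.\<close>
definition pp_labelling :: "partition \<Rightarrow> (pt set \<Rightarrow> nat) \<Rightarrow> bool" where
  "pp_labelling p lab \<longleftrightarrow> inj_on lab (pp_blocks p) \<and> (\<forall>b\<in>pp_blocks p. 1 \<le> lab b)"

text \<open>Reading order: upper row left to right, then lower row right to left.\<close>
definition pp_word :: "partition \<Rightarrow> (pt set \<Rightarrow> nat) \<Rightarrow> nat list" where
  "pp_word p lab = map (\<lambda>x. lab (THE b. b \<in> pp_blocks p \<and> x \<in> b))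
      (map Up [0..<pp_upper p] @ map Lo (rev [0..<pp_lower p]))"

definition F_of :: "partition set \<Rightarrow> nat list set" where
  "F_of C = {z2_red (pp_word p lab) | p lab. p \<in> C \<and> pp_labelling p lab}"

section \<open>The free group F_\<infinity> on x_1, x_2, ...\<close>

text \<open>Letters (False, k) = x_k, (True, k) = x_k^{-1}, k \<ge> 1; elements are reduced words.\<close>

definition fg_red :: "(bool \<times> nat) list \<Rightarrow> (bool \<times> nat) list" where
  "fg_red ws = foldr (\<lambda>a acc. case acc of [] \<Rightarrow> [a]
                  | c # r \<Rightarrow> (if snd a = snd c \<and> fst a \<noteq> fst c then r else a # acc)) ws []"

definition fg_reduced :: "(bool \<times> nat) list \<Rightarrow> bool" where
  "fg_reduced w \<longleftrightarrow> (\<forall>j. Suc j < length w \<longrightarrow>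
      \<not> (snd (w ! j) = snd (w ! Suc j) \<and> fst (w ! j) \<noteq> fst (w ! Suc j)))"

definition fg_inv :: "(bool \<times> nat) list \<Rightarrow> (bool \<times> nat) list" where
  "fg_inv w = rev (map (\<lambda>(b, i). (\<not> b, i)) w)"

definition free_grp :: "(bool \<times> nat) list monoid" where
  "free_grp = \<lparr> carrier = {w. fg_reduced w \<and> (\<forall>(b, i)\<in>set w. 1 \<le> i)},
                mult = (\<lambda>u v. fg_red (u @ v)),
                one = [] \<rparr>"

text \<open>The endomorphism of F_\<infinity> determined by the images g k of the generators x_k.\<close>
definition fg_endo :: "(nat \<Rightarrow> (bool \<times> nat) list) \<Rightarrow> (bool \<times> nat) list \<Rightarrow> (bool \<times> nat) list" where
  "fg_endo g w = fg_red (concat (map (\<lambda>(b, i). if b then fg_inv (g i) else g i) w))"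

inductive_set S_semigroup :: "((bool \<times> nat) list \<Rightarrow> (bool \<times> nat) list) set" where
  gen_i: "(\<forall>k. 1 \<le> k \<and> k \<le> n \<longrightarrow> 1 \<le> idx k) \<Longrightarrow>
          fg_endo (\<lambda>k. if 1 \<le> k \<and> k \<le> n then [(False, idx k)] else [(False, k)]) \<in> S_semigroup"
| gen_ii: "1 \<le> i \<Longrightarrow> fg_endo (\<lambda>k. fg_red [(True, i), (False, k)]) \<in> S_semigroup"
| gen_iii: "1 \<le> k \<Longrightarrow> fg_endo (\<lambda>j. if j = k then [] else [(False, j)]) \<in> S_semigroup"
| gen_iv: "fg_endo (\<lambda>k. [(True, k)]) \<in> S_semigroup"
| gen_v: "u \<in> carrier free_grp \<Longrightarrow> (\<lambda>w. fg_red (u @ w @ fg_inv u)) \<in> S_semigroup"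
| compose: "\<phi> \<in> S_semigroup \<Longrightarrow> \<psi> \<in> S_semigroup \<Longrightarrow> \<phi> \<circ> \<psi> \<in> S_semigroup"

definition S_invariant :: "(bool \<times> nat) list set \<Rightarrow> bool" where
  "S_invariant H \<longleftrightarrow> (\<forall>\<phi>\<in>S_semigroup. \<phi> ` H \<subseteq> H)"

text \<open>Identification of F_\<infinity> with E via x_k \<mapsto> a_1 a_{k+1}.\<close>
definition iota :: "(bool \<times> nat) list \<Rightarrow> nat list" where
  "iota w = z2_red (concat (map (\<lambda>(b, k). if b then [k + 1, 1] else [1, k + 1]) w))"

text \<open>F(C) transported to F_\<infinity> along this identification.\<close>
definition F_free :: "partition set \<Rightarrow> (bool \<times> nat) list set" where
  "F_free C = {w \<in> carrier free_grp. iota w \<in> F_of C}"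

end

theory Submission
  imports Defs "HOL-Library.Nat_Bijection"
begin

text \<open>
  Rotation identifies a category with the set of words in \<open>P(n,0)\<close> it contains, taken up to
  renaming of letters. For a simplifiable hyperoctahedral category this set of words is closed
  under every map on letters, under concatenation, reversal and rotation, and under inserting
  and deleting squares \<open>aa\<close> anywhere: the four block creates a square \<open>aa\<close> next to an existing
  letter \<open>a\<close>, the pair positioner moves it to any place, and capping the last two letters of
  \<open>bba\<close> identifies \<open>a\<close> with \<open>b\<close>. Conversely, every set of words with these closure properties comes
  from such a category, since composition of partitions becomes multiplication in
  \<open>G\<close> after both words have been relabelled by the connected components of the stacked picture.
  Sets of words of this kind are the preimages of the subgroups of \<open>E\<close> that are normal in \<open>G\<close>
  and invariant under all maps on letters; in terms of the basis \<open>x_k\<close> this is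
  \<open>S\<close>-invariance. Throughout, letters are numbered from 0, so that \<open>x_k\<close> is the word \<open>[0, k]\<close>.
\<close>

section \<open>Free reduction with respect to an involution\<close>

text \<open>The map \<open>i\<close> sends a letter to its inverse: the identity for a free product
  of copies of Z/2, the sign flip for a free group. Both groups of the theorem thus share one theory
  of reduced words.\<close>

definition cstep :: "('a \<Rightarrow> 'a) \<Rightarrow> 'a \<Rightarrow> 'a list \<Rightarrow> 'a list" where
  "cstep i a w = (case w of [] \<Rightarrow> [a] | b # r \<Rightarrow> if b = i a then r else a # w)"

definition cred :: "('a \<Rightarrow> 'a) \<Rightarrow> 'a list \<Rightarrow> 'a list" where
  "cred i w = foldr (cstep i) w []"

locale cancellation =
  fixes i :: "'a \<Rightarrow> 'a"
  assumes involution [simp]: "i (i a) = a"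
begin

abbreviation "red \<equiv> cred i"
abbreviation "reduced \<equiv> successively (\<lambda>a b. b \<noteq> i a)"

lemma reduced_cstep: "reduced w \<Longrightarrow> reduced (cstep i a w)"
  by (cases w) (auto simp: cstep_def successively_Cons)

lemma reduced_red: "reduced (red w)"
  by (induction w) (auto simp: cred_def reduced_cstep)

text \<open>If the inner step cancels, the head of \<open>w\<close> is \<open>a\<close>; since
  \<open>w\<close> is reduced, the next letter is not \<open>i a\<close>, so the outer step puts
  \<open>a\<close> back instead of cancelling once more.\<close>

lemma cstep_cstep: "reduced w \<Longrightarrow> cstep i a (cstep i (i a) w) = w"
  by (cases w) (auto simp: cstep_def successively_Cons split: list.splits)

lemma red_append_foldr: "red (u @ v) = foldr (cstep i) u (red v)"
  by (simp add: cred_def)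

lemma red_Cons: "red (a # v) = cstep i a (red v)"
  by (simp add: cred_def)

lemma red_cancel: "red (u @ [a, i a] @ v) = red (u @ v)"
  by (simp add: red_append_foldr red_Cons cstep_cstep reduced_red)

text \<open>The universal property of reduction: whatever ignores the deletion of one inverse pair
  ignores reduction altogether. All later transfers between words and group elements are instances
  with a suitable \<open>P\<close>.\<close>

lemma red_invariant:
  assumes P: "\<And>u a v. P (u @ [a, i a] @ v) = P (u @ v)"
  shows "P (red w) = P w"
proof -
  \<comment> \<open>The arbitrary prefix \<open>x\<close> absorbs the letters that the induction
    peels off.\<close>
  have "P (x @ red w) = P (x @ w)" for x
  proof (induction w arbitrary: x)
    case (Cons a w)
    have "P (x @ cstep i a (red w)) = P (x @ a # red w)"
      using P[of x a] by (auto simp: cstep_def split: list.splits)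
    with Cons[of "x @ [a]"] show ?case by (simp add: red_Cons)
  qed (simp add: cred_def)
  from this[of "[]"] show ?thesis by simp
qed

lemma red_red_mid: "red (u @ red w @ v) = red (u @ w @ v)"
  using red_invariant[of "\<lambda>w. red (u @ w @ v)"] red_cancel[of "u @ _"] by simp

lemma red_append_red: "red (u @ red v) = red (u @ v)"
  using red_red_mid[of u _ "[]"] by simp

lemma red_red_append: "red (red u @ v) = red (u @ v)"
  using red_red_mid[of "[]" _ "v"] by simp

lemma red_append_cong: "red u = red u' \<Longrightarrow> red v = red v' \<Longrightarrow> red (u @ v) = red (u' @ v')"
  by (metis red_append_red red_red_append)

lemma red_reduced: "reduced w \<Longrightarrow> red w = w"
proof (induction w)
  case (Cons a w)
  then show ?case
    by (cases w) (auto simp: red_Cons cstep_def successively_Cons)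
qed (simp add: cred_def)

lemma set_red: "set (red w) \<subseteq> set w"
proof (induction w)
  case (Cons a w)
  then show ?case by (auto simp: red_Cons cstep_def split: list.splits if_splits)
qed (simp add: cred_def)

lemma red_Nil [simp]: "red [] = []"
  by (simp add: cred_def)

lemma red_inverse_right: "red (w @ rev (map i w)) = []"
proof (induction w)
  case (Cons a w)
  have "red ((a # w) @ rev (map i (a # w))) = red ([a] @ red (w @ rev (map i w)) @ [i a])"
    by (simp add: red_red_mid flip: append_assoc)
       (use red_red_mid[of "[a]" "w @ rev (map i w)" "[i a]"] in simp)
  then show ?case using Cons red_cancel[of "[]" a "[]"] by simp
qed simp

lemma red_inverse_left: "red (rev (map i w) @ w) = []"
  using red_inverse_right[of "rev (map i w)"] by (simp add: rev_map comp_def)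

lemma even_length_red: "even (length (red w)) = even (length w)"
  by (rule red_invariant[of "\<lambda>w. even (length w)"]) simp

end

section \<open>The two instances: involutive generators and signed generators\<close>

abbreviation flip :: "bool \<times> nat \<Rightarrow> bool \<times> nat" where
  "flip \<equiv> \<lambda>(b, k). (\<not> b, k)"

interpretation z2: cancellation "\<lambda>a::nat. a"
  by standard simp

interpretation fg: cancellation flip
  by standard auto

lemma z2_red_eq: "z2_red = cred (\<lambda>a. a)"
  unfolding z2_red_def cred_def cstep_def
  by (intro ext arg_cong2[where f="\<lambda>f w. foldr f w []"]) (auto split: list.splits)

lemma fg_red_eq: "fg_red = cred flip"
  unfolding fg_red_def cred_def cstep_def
  by (intro ext arg_cong2[where f="\<lambda>f w. foldr f w []"]) (auto split: list.splits)

lemma z2_reduced_iff: "z2_reduced w \<longleftrightarrow> z2.reduced w"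
  by (auto simp: z2_reduced_def successively_conv_nth)

lemma fg_reduced_iff: "fg_reduced w \<longleftrightarrow> fg.reduced w"
proof -
  have "\<not> (snd a = snd b \<and> fst a \<noteq> fst b) \<longleftrightarrow> b \<noteq> flip a" for a b :: "bool \<times> nat"
    by (cases a; cases b) auto
  then show ?thesis unfolding fg_reduced_def successively_conv_nth by simp
qed

lemma fg_inv_eq: "fg_inv w = rev (map flip w)"
  by (simp add: fg_inv_def)

section \<open>Letter-invariant sets of words\<close>

definition subst1 :: "nat \<Rightarrow> nat \<Rightarrow> nat \<Rightarrow> nat" where
  "subst1 b a = (\<lambda>x. if x = b then a else x)"

lemma map_subst1_idem: "b \<notin> set w \<Longrightarrow> map (subst1 b a) w = w"
  by (auto simp: subst1_def intro!: map_idI)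

lemma subst1_simps [simp]: "subst1 b a b = a" "x \<noteq> b \<Longrightarrow> subst1 b a x = x"
  by (auto simp: subst1_def)

lemma ex_fresh: "\<exists>c::nat. c \<notin> set w \<and> c \<noteq> d"
  using ex_new_if_finite[of "set (d # w)"] by auto

text \<open>The object midway between categories and subgroups. By \<open>cancel_iff\<close>
  membership depends only on the element of G; \<open>append_closed\<close>,
  \<open>rev_closed\<close> and \<open>Nil_mem\<close> make these elements a subgroup,
  \<open>rotate_closed\<close> makes it normal, and \<open>map_closed\<close> covers all maps on
  letters, including those that identify letters.\<close>

locale letter_invariant =
  fixes K :: "nat list set"
  assumes map_closed: "w \<in> K \<Longrightarrow> map f w \<in> K"
    and append_closed: "u \<in> K \<Longrightarrow> v \<in> K \<Longrightarrow> u @ v \<in> K"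
    and rev_closed: "w \<in> K \<Longrightarrow> rev w \<in> K"
    and rotate_closed: "u @ v \<in> K \<Longrightarrow> v @ u \<in> K"
    and cancel_iff: "u @ [a, a] @ v \<in> K \<longleftrightarrow> u @ v \<in> K"
    and Nil_mem: "[] \<in> K"
begin

lemma z2_red_mem: "z2_red w \<in> K \<longleftrightarrow> w \<in> K"
  unfolding z2_red_eq using z2.red_invariant[of "\<lambda>w. w \<in> K"] cancel_iff by simp

lemma z2_red_cong: "z2_red u = z2_red v \<Longrightarrow> u \<in> K \<longleftrightarrow> v \<in> K"
  by (metis z2_red_mem)

lemma cancel_rev_iff: "u @ rev s @ s @ v \<in> K \<longleftrightarrow> u @ v \<in> K"
proof (induction s arbitrary: u v)
  case (Cons a s)
  then show ?case using cancel_iff[of "u @ rev s" a "s @ v"] by simp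
qed simp

lemma inj_map_iff: "inj_on f (set w) \<Longrightarrow> map f w \<in> K \<longleftrightarrow> w \<in> K"
  using map_closed[of "map f w" "the_inv_into (set w) f"] map_closed[of w f]
  by (auto simp: comp_def the_inv_into_f_f cong: map_cong)

text \<open>Rotation turns the conjugate into \<open>w @ rev s @ s\<close>, whose tail
  cancels.\<close>

lemma conjugate_iff: "s @ w @ rev s \<in> K \<longleftrightarrow> w \<in> K"
  using rotate_closed[of s "w @ rev s"] rotate_closed[of "w @ rev s" s] cancel_rev_iff[of w s "[]"]
  by auto

text \<open>A constant letter map turns an odd word into an odd power of \<open>a\<close>, which
  cancels down to \<open>[a]\<close>; then \<open>[0]\<close> and \<open>[1]\<close> give
  \<open>[0, 1]\<close>, the word of the double singleton.\<close>

lemma even_length: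
  assumes "[0, 1] \<notin> K" "w \<in> K"
  shows "even (length w)"
proof (rule ccontr)
  assume odd: "odd (length w)"
  have rep: "replicate (Suc (2 * n)) a \<in> K \<Longrightarrow> [a] \<in> K" for n a
  proof (induction n)
    case (Suc n)
    then show ?case using cancel_iff[of "[]" a "replicate (Suc (2 * n)) a"] by simp
  qed simp
  from odd obtain n where n: "length w = Suc (2 * n)" by (metis oddE Suc_eq_plus1)
  have "[a] \<in> K" for a
    using rep[of n a] map_closed[OF assms(2), of "\<lambda>_. a"] n by (simp add: map_replicate_const)
  from append_closed[OF this[of 0] this[of 1]] assms(1) show False by simp
qed

end

text \<open>What a category provides directly, in terms of words: renaming of letters, rotation,
  reflection, the tensor product (only for disjoint letters), composition with the reflected pair
  partition at the end (\<open>cap_end\<close>), and three special partitions. The rest of the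
  locale derives \<open>letter_invariant\<close> from this.\<close>

locale simplifiable_words =
  fixes W :: "nat list set"
  assumes inj_map: "w \<in> W \<Longrightarrow> inj_on f (set w) \<Longrightarrow> map f w \<in> W"
    and rotate: "u @ v \<in> W \<Longrightarrow> v @ u \<in> W"
    and reverse: "w \<in> W \<Longrightarrow> rev w \<in> W"
    and disjoint_append: "u \<in> W \<Longrightarrow> v \<in> W \<Longrightarrow> set u \<inter> set v = {} \<Longrightarrow> u @ v \<in> W"
    and cap_end: "w @ [a, b] \<in> W \<Longrightarrow> map (subst1 b a) w \<in> W"
    and pair_mem: "[0, 0] \<in> W"
    and four_mem: "[0, 0, 0, 0] \<in> W"
    and rho_mem: "[0, 0, 1, 0, 0, 1] \<in> W"
begin

lemma cap:
  assumes "u @ [a, b] @ v \<in> W"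
  shows "map (subst1 b a) (u @ v) \<in> W"
proof -
  from rotate[of "u @ [a, b]" v] assms have "(v @ u) @ [a, b] \<in> W" by simp
  from cap_end[OF this] show ?thesis using rotate by simp
qed

lemma delete_pair: "u @ [a, a] @ v \<in> W \<Longrightarrow> u @ v \<in> W"
  using cap[of u a a v] by (simp add: subst1_def)

lemma insert_disjoint:
  assumes "u @ v \<in> W" "x \<in> W" "set x \<inter> set (u @ v) = {}"
  shows "u @ x @ v \<in> W"
proof -
  have "v @ u \<in> W" using assms(1) by (rule rotate)
  then have "(v @ u) @ x \<in> W" using assms by (intro disjoint_append[of "v @ u" x]) auto
  with rotate[of v "u @ x"] show ?thesis by simp
qed

lemma pair_mem': "[c, c] \<in> W"
  using inj_map[OF pair_mem, of "\<lambda>_. c"] by simp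

lemma four_mem': "[c, c, c, c] \<in> W"
  using inj_map[OF four_mem, of "\<lambda>_. c"] by simp

lemma rho_mem': "a \<noteq> b \<Longrightarrow> [b, a, a, b, a, a] \<in> W"
  using inj_map[OF rho_mem, of "\<lambda>x. if x = 0 then a else b"]
    rotate[of "[a, a, b, a, a]" "[b]"] by (simp add: inj_on_def)

text \<open>Insert \<open>[c, c, c, c]\<close> with a fresh \<open>c\<close> behind \<open>a\<close>
  and cap the adjacent \<open>a\<close> and \<open>c\<close>: the remaining three letters
  \<open>c\<close> become \<open>a\<close>.\<close>

lemma triple:
  assumes "u @ [a] @ v \<in> W"
  shows "u @ [a, a] @ [a] @ v \<in> W"
proof -
  obtain c where c: "c \<notin> set (u @ [a] @ v)" using ex_fresh by blast
  have "(u @ [a]) @ [c, c, c, c] @ v \<in> W"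
    using assms c by (intro insert_disjoint four_mem') auto
  then have "u @ [a, c] @ [c, c, c] @ v \<in> W" by simp
  from cap[OF this] c show ?thesis by (simp add: map_subst1_idem)
qed

text \<open>A fresh copy \<open>[b, a, a, b, a, a]\<close> of the pair positioner goes behind
  \<open>[x, x, z]\<close>. Capping \<open>z\<close> with \<open>b\<close> leaves
  \<open>[x, x, a, a, z, a, a]\<close>, capping \<open>x\<close> with \<open>a\<close> leaves
  \<open>[x, x, z, x, x]\<close>, and the first square is deleted.\<close>

lemma move_pair_right1:
  assumes "u @ [x, x] @ [z] @ v \<in> W"
  shows "u @ [z] @ [x, x] @ v \<in> W"
proof (cases "x = z")
  case False
  obtain b where b: "b \<notin> set (u @ [x, x] @ [z] @ v)" using ex_fresh by blast
  obtain a where a: "a \<notin> set (u @ [x, x] @ [z] @ v)" "a \<noteq> b" using ex_fresh by blast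
  have "(u @ [x, x, z]) @ [b, a, a, b, a, a] @ v \<in> W"
    using assms a b by (intro insert_disjoint rho_mem') auto
  then have "(u @ [x, x]) @ [z, b] @ [a, a, b, a, a] @ v \<in> W" by simp
  from cap[OF this] a b have "(u @ [x]) @ [x, a] @ [a, z, a, a] @ v \<in> W"
    by (auto simp: map_subst1_idem)
  from cap[OF this] a b have "u @ [x, x] @ [z, x, x] @ v \<in> W"
    by (auto simp: map_subst1_idem)
  from delete_pair[OF this] show ?thesis by simp
qed (use assms in simp)

lemma move_pair_left1:
  assumes "u @ [z] @ [x, x] @ v \<in> W"
  shows "u @ [x, x] @ [z] @ v \<in> W"
  using reverse[OF move_pair_right1[of "rev v" x z "rev u"]] reverse[OF assms] by simp

lemma move_pair_left:
  "u @ m @ [x, x] @ v \<in> W \<Longrightarrow> u @ [x, x] @ m @ v \<in> W"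
proof (induction m arbitrary: u v)
  case (Cons z m)
  from Cons.prems Cons.IH[of "u @ [z]" v] have "(u @ [z]) @ [x, x] @ m @ v \<in> W" by simp
  with move_pair_left1[of u z x "m @ v"] show ?case by simp
qed simp

lemma cancel: "u @ [a, a] @ v \<in> W \<longleftrightarrow> u @ v \<in> W"
proof
  assume uv: "u @ v \<in> W"
  show "u @ [a, a] @ v \<in> W"
  proof (cases "a \<in> set (v @ u)")
    case True
    \<comment> \<open>In the rotated word \<open>v @ u\<close> the place of insertion is the front,
      so moving the new square to the left suffices.\<close>
    then obtain s t where st: "v @ u = s @ [a] @ t" by (metis append_Cons append_Nil split_list)
    from rotate[OF uv] have "[] @ s @ [a, a] @ [a] @ t \<in> W" using st triple by simp
    from move_pair_left[OF this] have "([a, a] @ v) @ u \<in> W" using st by simp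
    from rotate[OF this] show ?thesis by simp
  next
    case False
    then show ?thesis using uv by (intro insert_disjoint pair_mem') auto
  qed
qed (rule delete_pair)

lemma identify:
  assumes "w \<in> W"
  shows "map (subst1 a b) w \<in> W"
proof (cases "a \<in> set w")
  case True
  then obtain u v where w: "w = u @ [a] @ v" by (metis append_Cons append_Nil split_list)
  from assms have "u @ [b, b] @ [a] @ v \<in> W" unfolding w by (simp only: cancel)
  then have "(u @ [b]) @ [b, a] @ v \<in> W" by simp
  from cap[OF this] show ?thesis
    unfolding w by (cases "a = b") (simp_all add: subst1_def)
qed (use assms in \<open>simp add: map_subst1_idem\<close>)

lemma map_mem:
  assumes "w \<in> W"
  shows "map f w \<in> W"
proof -
  \<comment> \<open>Shift all letters beyond the range of \<open>f\<close>, then replace them one at a time.\<close>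
  obtain N where N: "\<And>x. x \<in> set w \<Longrightarrow> f x < N"
    using finite_nat_set_iff_bounded[of "f ` set w"] by auto
  have "map (\<lambda>x. if x \<in> A then f x else x + N) w \<in> W" if "finite A" for A
    using that
  proof (induction A)
    case empty
    show ?case using inj_map[OF assms, of "\<lambda>x. x + N"] by (simp add: inj_on_def)
  next
    case (insert a A)
    have "map (subst1 (a + N) (f a)) (map (\<lambda>x. if x \<in> A then f x else x + N) w)
        = map (\<lambda>x. if x \<in> insert a A then f x else x + N) w"
      using insert.hyps(2) N by (fastforce simp: subst1_def)
    with identify[OF insert.IH] show ?case by metis
  qed
  from this[of "set w"] show ?thesis by (simp cong: map_cong)
qed

text \<open>The tensor product needs disjoint letters. Therefore \<open>v\<close> is first shifted
  by a bound \<open>N\<close> of the letters of \<open>u\<close>, and a letter map, now available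
  for non-injective maps too, shifts it back.\<close>

lemma append_mem:
  assumes "u \<in> W" "v \<in> W"
  shows "u @ v \<in> W"
proof -
  obtain N where N: "\<And>x. x \<in> set u \<Longrightarrow> x < N"
    using finite_nat_set_iff_bounded[of "set u"] by auto
  have "u @ map (\<lambda>x. x + N) v \<in> W"
    using assms N by (intro disjoint_append map_mem) fastforce+
  from map_mem[OF this, of "\<lambda>x. if x < N then x else x - N"] N
  show ?thesis by (simp add: comp_def map_idI)
qed

sublocale letter_invariant W
  using map_mem append_mem reverse rotate cancel delete_pair[of "[]" 0 "[]"] pair_mem
  by unfold_locales auto

end

section \<open>Partitions as kernels of labellings\<close>

definition kernel_blocks :: "'a set \<Rightarrow> ('a \<Rightarrow> 'b) \<Rightarrow> 'a set set" where
  "kernel_blocks A f = (\<lambda>x. {y \<in> A. f y = f x}) ` A"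

text \<open>Blocks are encoded as level sets of a labelling, of which only the equalities between
  labels matter. Operations on partitions then become operations on functions, and words are read
  off directly.\<close>

definition kernel_part :: "nat \<Rightarrow> nat \<Rightarrow> (pt \<Rightarrow> nat) \<Rightarrow> partition" where
  "kernel_part k l f = (k, l, kernel_blocks (pp_points k l) f)"

definition reading :: "nat \<Rightarrow> nat \<Rightarrow> pt list" where
  "reading k l = map Up [0..<k] @ map Lo (rev [0..<l])"

definition word :: "nat \<Rightarrow> nat \<Rightarrow> (pt \<Rightarrow> nat) \<Rightarrow> nat list" where
  "word k l f = map f (reading k l)"

text \<open>The representative of \<open>w\<close> without lower points; the 0 is only a default
  value.\<close>

definition word_part :: "nat list \<Rightarrow> partition" where
  "word_part w = kernel_part (length w) 0 (case_pt (nth w) (\<lambda>_. 0))"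

lemma pp_points_simps [simp]:
  "Up i \<in> pp_points k l \<longleftrightarrow> i < k" "Lo j \<in> pp_points k l \<longleftrightarrow> j < l"
  by (auto simp: pp_points_def)

lemma set_reading [simp]: "set (reading k l) = pp_points k l"
  by (auto simp: reading_def pp_points_def)

lemma finite_pp_points [simp]: "finite (pp_points k l)"
  by (metis List.finite_set set_reading)

lemma kernel_blocks_cong:
  assumes "\<And>x y. x \<in> A \<Longrightarrow> y \<in> A \<Longrightarrow> f x = f y \<longleftrightarrow> g x = g y"
  shows "kernel_blocks A f = kernel_blocks A g"
  unfolding kernel_blocks_def using assms by (intro image_cong) auto

lemma kernel_blocks_eqD:
  fixes f g :: "'a \<Rightarrow> 'b"
  assumes "kernel_blocks A f = kernel_blocks A g" "x \<in> A" "y \<in> A"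
  shows "f x = f y \<longleftrightarrow> g x = g y"
proof -
  have *: "g x = g y" if eq: "kernel_blocks A f = kernel_blocks A g" and "f x = f y" "x \<in> A" "y \<in> A"
    for f g :: "'a \<Rightarrow> 'b" and x y
  proof -
    have "{z \<in> A. f z = f x} \<in> kernel_blocks A g"
      using that by (auto simp: kernel_blocks_def simp flip: eq)
    then obtain z where "{z \<in> A. f z = f x} = {y \<in> A. g y = g z}"
      by (auto simp: kernel_blocks_def)
    with that have "x \<in> {y \<in> A. g y = g z}" "y \<in> {y \<in> A. g y = g z}" by auto
    then show ?thesis by simp
  qed
  show ?thesis using *[of f g x y] *[of g f x y] assms by metis
qed

lemma kernel_part_eq_iff:
  "kernel_part k l f = kernel_part k' l' g \<longleftrightarrow>
     k = k' \<and> l = l' \<and> (\<forall>x\<in>pp_points k l. \<forall>y\<in>pp_points k l. f x = f y \<longleftrightarrow> g x = g y)"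
  unfolding kernel_part_def
  by (auto intro!: kernel_blocks_cong dest: kernel_blocks_eqD)

lemma word_cong: "(\<And>x. x \<in> pp_points k l \<Longrightarrow> f x = g x) \<Longrightarrow> word k l f = word k l g"
  by (simp add: word_def)

lemma kernel_part_cong:
  "(\<And>x. x \<in> pp_points k l \<Longrightarrow> f x = g x) \<Longrightarrow> kernel_part k l f = kernel_part k l g"
  by (simp add: kernel_part_eq_iff)

lemma ex_factor:
  assumes "\<And>x y. x \<in> A \<Longrightarrow> y \<in> A \<Longrightarrow> f x = f y \<Longrightarrow> g x = g y"
  shows "\<exists>h. \<forall>x\<in>A. g x = h (f x)"
proof -
  have "g x = g (inv_into A f (f x))" if "x \<in> A" for x
    using that assms[of x "inv_into A f (f x)"] by (simp add: f_inv_into_f inv_into_into)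
  then show ?thesis by (intro exI[of _ "g \<circ> inv_into A f"]) auto
qed

text \<open>Coarsening a labelling amounts to applying a letter map to its word. This is how
  \<open>map_closed\<close> gets applied to partitions.\<close>

lemma word_factor:
  assumes "\<And>x y. x \<in> pp_points k l \<Longrightarrow> y \<in> pp_points k l \<Longrightarrow> f x = f y \<Longrightarrow> g x = g y"
  shows "\<exists>h. word k l g = map h (word k l f)"
  using ex_factor[OF assms] by (auto simp: word_def)

lemma kernel_part_simps [simp]:
  "pp_upper (kernel_part k l f) = k" "pp_lower (kernel_part k l f) = l"
  "pp_blocks (kernel_part k l f) = kernel_blocks (pp_points k l) f"
  by (simp_all add: kernel_part_def pp_upper_def pp_lower_def pp_blocks_def)

lemma pp_valid_kernel_part: "pp_valid (kernel_part k l f)"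
  by (auto simp: pp_valid_def kernel_part_def kernel_blocks_def)

text \<open>The labelling is written with \<open>THE\<close> exactly as in \<open>pp_word\<close>,
  so that the word of a labelled partition is the \<open>word\<close> of this very function.\<close>

lemma valid_eq_kernel_part:
  assumes "pp_valid p" "inj_on lab (pp_blocks p)"
  shows "p = kernel_part (pp_upper p) (pp_lower p) (\<lambda>x. lab (THE b. b \<in> pp_blocks p \<and> x \<in> b))"
proof -
  obtain k l B where p: "p = (k, l, B)" by (cases p)
  let ?bl = "\<lambda>x. THE b. b \<in> B \<and> x \<in> b"
  have un: "\<Union>B = pp_points k l" and ne: "{} \<notin> B"
    and dj: "\<And>b c. b \<in> B \<Longrightarrow> c \<in> B \<Longrightarrow> b \<noteq> c \<Longrightarrow> b \<inter> c = {}"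
    using assms(1) by (auto simp: pp_valid_def p)
  have bl: "?bl x = b" if "b \<in> B" "x \<in> b" for x b
    using that dj by (intro the_equality) blast+
  have inj: "inj_on lab B" using assms(2) by (simp add: p pp_blocks_def)
  have blk: "{y \<in> pp_points k l. lab (?bl y) = lab (?bl x)} = b" if "b \<in> B" "x \<in> b" for x b
  proof -
    have "lab (?bl y) = lab b \<longleftrightarrow> y \<in> b" if y: "y \<in> pp_points k l" for y
    proof -
      obtain c where c: "c \<in> B" "y \<in> c" using y un by blast
      then show ?thesis using inj \<open>b \<in> B\<close> bl dj[of b c] by (auto dest: inj_onD)
    qed
    then show ?thesis using that un bl by auto
  qed
  have "B = kernel_blocks (pp_points k l) (\<lambda>x. lab (?bl x))"
  proof (intro equalityI subsetI)
    fix b assume b: "b \<in> B"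
    then obtain x where x: "x \<in> b" using ne by fastforce
    with b un have "x \<in> pp_points k l" by blast
    with blk[OF b x] show "b \<in> kernel_blocks (pp_points k l) (\<lambda>x. lab (?bl x))"
      unfolding kernel_blocks_def by (metis (no_types, lifting) imageI)
  next
    fix b assume "b \<in> kernel_blocks (pp_points k l) (\<lambda>x. lab (?bl x))"
    then obtain x where "x \<in> pp_points k l"
      "b = {y \<in> pp_points k l. lab (?bl y) = lab (?bl x)}"
      by (auto simp: kernel_blocks_def)
    with un blk show "b \<in> B" by auto
  qed
  then show ?thesis by (simp add: p kernel_part_def pp_upper_def pp_lower_def pp_blocks_def)
qed

lemma valid_ex_kernel_part:
  assumes "pp_valid p"
  shows "\<exists>k l f. p = kernel_part k l f"
proof -
  have "finite (pp_blocks p)"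
  proof (rule finite_subset)
    show "pp_blocks p \<subseteq> Pow (pp_points (pp_upper p) (pp_lower p))"
      using assms by (cases p) (auto simp: pp_valid_def pp_blocks_def pp_upper_def pp_lower_def)
  qed simp
  then obtain lab :: "pt set \<Rightarrow> nat" where "inj_on lab (pp_blocks p)"
    using finite_imp_inj_to_nat_seg by blast
  from valid_eq_kernel_part[OF assms this] show ?thesis by blast
qed

lemma pp_word_eq:
  "pp_word p lab = word (pp_upper p) (pp_lower p) (\<lambda>x. lab (THE b. b \<in> pp_blocks p \<and> x \<in> b))"
  by (simp add: pp_word_def word_def reading_def)

text \<open>Since \<open>f\<close> is constant on each block, a block may be labelled by the value
  of \<open>f\<close> at any chosen point of it.\<close>

lemma ex_labelling:
  assumes "\<And>x. x \<in> pp_points k l \<Longrightarrow> 1 \<le> f x"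
  shows "\<exists>lab. pp_labelling (kernel_part k l f) lab \<and> pp_word (kernel_part k l f) lab = word k l f"
proof -
  let ?A = "pp_points k l"
  let ?B = "\<lambda>x. {y \<in> ?A. f y = f x}"
  define lab where "lab b = f (SOME x. x \<in> b)" for b
  have lab: "lab (?B x) = f x" if "x \<in> ?A" for x
    using someI[of "\<lambda>y. y \<in> ?B x" x] that by (auto simp: lab_def)
  have "inj_on lab (kernel_blocks ?A f)"
    by (auto simp: inj_on_def kernel_blocks_def lab)
  moreover have "(THE b. b \<in> kernel_blocks ?A f \<and> x \<in> b) = ?B x" if "x \<in> ?A" for x
    using that by (intro the_equality) (auto simp: kernel_blocks_def)
  ultimately show ?thesis
    using assms lab
    by (intro exI[of _ lab]) (auto simp: pp_labelling_def pp_word_eq kernel_blocks_def intro!: word_cong)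
qed

text \<open>The common principle behind reflection, the rotations and the shift in the tensor
  product: moving points along \<phi> carries the kernel of a labelling to the kernel of the
  transported labelling.\<close>

lemma kernel_blocks_image:
  assumes "\<phi> ` A = B" "\<And>x. x \<in> A \<Longrightarrow> g (\<phi> x) = f x"
  shows "(\<lambda>b. \<phi> ` b) ` kernel_blocks A f = kernel_blocks B g"
proof -
  have "\<phi> ` {y \<in> A. f y = f x} = {z \<in> B. g z = g (\<phi> x)}" if "x \<in> A" for x
    using assms that by auto
  then show ?thesis
    unfolding kernel_blocks_def image_image assms(1)[symmetric] by (intro image_cong) auto
qed

lemma image_eq_inverse:
  assumes "\<And>x. x \<in> A \<Longrightarrow> \<phi> x \<in> B" "\<And>y. y \<in> B \<Longrightarrow> \<psi> y \<in> A \<and> \<phi> (\<psi> y) = y"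
  shows "\<phi> ` A = B"
  using assms by (auto simp: image_iff) metis

section \<open>Reflection and rotations of kernels and their words\<close>

lemma pp_star_kernel_part: "pp_star (kernel_part k l f) = kernel_part l k (f \<circ> pp_flip)"
proof -
  have "pp_flip (pp_flip x) = x" for x by (cases x) auto
  moreover have "pp_flip x \<in> pp_points l k" if "x \<in> pp_points k l" for x k l
    using that by (cases x) auto
  ultimately show ?thesis
    unfolding pp_star_def kernel_part_def
    by (auto intro!: kernel_blocks_image image_eq_inverse[where \<psi>=pp_flip])
qed

lemma word_star: "word l k (f \<circ> pp_flip) = rev (word k l f)"
  by (simp add: word_def reading_def rev_map)

lemma rotUL_LU: "pp_rotUL_map (pp_rotLU_map x) = x" "pp_rotLU_map (pp_rotUL_map x) = x"
  by (cases x; auto)+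

lemma rotUL_LU_mem:
  "x \<in> pp_points (Suc k) l \<Longrightarrow> pp_rotUL_map x \<in> pp_points k (Suc l)"
  "x \<in> pp_points k (Suc l) \<Longrightarrow> pp_rotLU_map x \<in> pp_points (Suc k) l"
  by (cases x; auto)+

lemma pp_rotUL_kernel_part:
  "pp_rotUL (kernel_part (Suc k) l f) = kernel_part k (Suc l) (f \<circ> pp_rotLU_map)"
  unfolding pp_rotUL_def kernel_part_def using rotUL_LU_mem
  by (auto simp: rotUL_LU intro!: kernel_blocks_image image_eq_inverse[where \<psi>=pp_rotLU_map])

lemma pp_rotLU_kernel_part:
  "pp_rotLU (kernel_part k (Suc l) f) = kernel_part (Suc k) l (f \<circ> pp_rotUL_map)"
  unfolding pp_rotLU_def kernel_part_def using rotUL_LU_mem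
  by (auto simp: rotUL_LU intro!: kernel_blocks_image image_eq_inverse[where \<psi>=pp_rotUL_map])

lemma rotUR_LR:
  "x \<in> pp_points k (Suc l) \<Longrightarrow> pp_rotUR_map (Suc k) l (pp_rotLR_map k (Suc l) x) = x"
  "x \<in> pp_points (Suc k) l \<Longrightarrow> pp_rotLR_map k (Suc l) (pp_rotUR_map (Suc k) l x) = x"
  by (cases x; auto)+

lemma rotUR_LR_mem:
  "x \<in> pp_points (Suc k) l \<Longrightarrow> pp_rotUR_map (Suc k) l x \<in> pp_points k (Suc l)"
  "x \<in> pp_points k (Suc l) \<Longrightarrow> pp_rotLR_map k (Suc l) x \<in> pp_points (Suc k) l"
  by (cases x; auto)+

lemma pp_rotUR_kernel_part:
  "pp_rotUR (kernel_part (Suc k) l f) = kernel_part k (Suc l) (f \<circ> pp_rotLR_map k (Suc l))"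
  unfolding pp_rotUR_def kernel_part_def using rotUR_LR_mem rotUR_LR
  by (auto intro!: kernel_blocks_image image_eq_inverse[where \<psi>="pp_rotLR_map k (Suc l)"])

lemma pp_rotLR_kernel_part:
  "pp_rotLR (kernel_part k (Suc l) f) = kernel_part (Suc k) l (f \<circ> pp_rotUR_map (Suc k) l)"
  unfolding pp_rotLR_def kernel_part_def using rotUR_LR_mem rotUR_LR
  by (auto intro!: kernel_blocks_image image_eq_inverse[where \<psi>="pp_rotUR_map (Suc k) l"])

lemma upt_Suc_Cons: "[0..<Suc n] = 0 # map Suc [0..<n]"
  by (simp add: upt_conv_Cons map_Suc_upt del: upt_Suc)

lemma word_rotUL:
  "\<exists>a w. word (Suc k) l f = a # w \<and> word k (Suc l) (f \<circ> pp_rotLU_map) = w @ [a]"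
  unfolding word_def reading_def
  by (simp add: upt_Suc_Cons rev_map comp_def del: upt_Suc)

lemma word_rotLU:
  "\<exists>a w. word k (Suc l) f = w @ [a] \<and> word (Suc k) l (f \<circ> pp_rotUL_map) = a # w"
  unfolding word_def reading_def
  by (simp add: upt_Suc_Cons rev_map comp_def del: upt_Suc)

text \<open>The reading order passes from the right end of the upper row to the right end of the
  lower row, so right rotations leave the word unchanged; left rotations carry a letter from one end
  of the word to the other.\<close>

lemma word_rotLR: "word (Suc k) l (f \<circ> pp_rotUR_map (Suc k) l) = word k (Suc l) f"
  by (simp add: word_def reading_def)

lemma word_rotUR: "word k (Suc l) (f \<circ> pp_rotLR_map k (Suc l)) = word (Suc k) l f"
  by (simp add: word_def reading_def)

section \<open>The tensor product\<close>

definition juxtapose :: "nat \<Rightarrow> nat \<Rightarrow> (pt \<Rightarrow> 'a) \<Rightarrow> (pt \<Rightarrow> 'a) \<Rightarrow> pt \<Rightarrow> 'a" where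
  "juxtapose k l f g x = (case x of
      Up i \<Rightarrow> if i < k then f (Up i) else g (Up (i - k))
    | Lo j \<Rightarrow> if j < l then f (Lo j) else g (Lo (j - l)))"

lemma juxtapose_left: "x \<in> pp_points k l \<Longrightarrow> juxtapose k l f g x = f x"
  by (cases x) (auto simp: juxtapose_def)

lemma juxtapose_shift: "juxtapose k l f g (pp_shift k l x) = g x"
  by (cases x) (auto simp: juxtapose_def)

lemma pp_points_add: "pp_points (k + k') (l + l') = pp_points k l \<union> pp_shift k l ` pp_points k' l'"
proof (intro equalityI subsetI)
  fix x assume x: "x \<in> pp_points (k + k') (l + l')"
  show "x \<in> pp_points k l \<union> pp_shift k l ` pp_points k' l'"
  proof (cases x)
    case (Up i)
    then have "i < k \<or> x = pp_shift k l (Up (i - k)) \<and> i - k < k'" using x by auto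
    then show ?thesis using Up by (metis UnI1 UnI2 imageI pp_points_simps(1))
  next
    case (Lo i)
    then have "i < l \<or> x = pp_shift k l (Lo (i - l)) \<and> i - l < l'" using x by auto
    then show ?thesis using Lo by (metis UnI1 UnI2 imageI pp_points_simps(2))
  qed
next
  fix x assume "x \<in> pp_points k l \<union> pp_shift k l ` pp_points k' l'"
  then show "x \<in> pp_points (k + k') (l + l')"
    by (auto simp: pp_points_def)
qed

lemma kernel_blocks_Un:
  assumes "f ` A \<inter> f ` B = {}"
  shows "kernel_blocks (A \<union> B) f = kernel_blocks A f \<union> kernel_blocks B f"
proof -
  have "{y \<in> A \<union> B. f y = f x} = {y \<in> A. f y = f x}" if "x \<in> A" for x
    using assms that by auto
  moreover have "{y \<in> A \<union> B. f y = f x} = {y \<in> B. f y = f x}" if "x \<in> B" for x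
    using assms that by (auto simp: disjoint_iff image_iff)
  ultimately show ?thesis
    unfolding kernel_blocks_def by (simp add: image_Un)
qed

lemma set_word: "set (word k l f) = f ` pp_points k l"
  by (simp add: word_def)

lemma pp_tensor_kernel_part:
  assumes "set (word k l f) \<inter> set (word k' l' g) = {}"
  shows "pp_tensor (kernel_part k l f) (kernel_part k' l' g)
       = kernel_part (k + k') (l + l') (juxtapose k l f g)"
proof -
  let ?h = "juxtapose k l f g"
  have "?h ` pp_points k l \<inter> ?h ` pp_shift k l ` pp_points k' l' = {}"
    using assms by (auto simp: set_word juxtapose_left juxtapose_shift)
  then have "kernel_blocks (pp_points (k + k') (l + l')) ?h
      = kernel_blocks (pp_points k l) ?h \<union> kernel_blocks (pp_shift k l ` pp_points k' l') ?h"
    by (simp add: pp_points_add kernel_blocks_Un)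
  also have "kernel_blocks (pp_points k l) ?h = kernel_blocks (pp_points k l) f"
    by (intro kernel_blocks_cong) (simp add: juxtapose_left)
  also have "kernel_blocks (pp_shift k l ` pp_points k' l') ?h
      = (\<lambda>b. pp_shift k l ` b) ` kernel_blocks (pp_points k' l') g"
    by (rule kernel_blocks_image[symmetric]) (auto simp: juxtapose_shift)
  finally show ?thesis by (simp add: pp_tensor_def kernel_part_def)
qed

text \<open>The lower row is read from right to left, so the word of the right factor lands between
  the upper and the lower part of the left one.\<close>

lemma word_juxtapose:
  "word (k + k') (l + l') (juxtapose k l f g)
     = map f (map Up [0..<k]) @ word k' l' g @ map f (map Lo (rev [0..<l]))"
proof -
  have "[0..<n + m] = [0..<n] @ map (\<lambda>i. i + n) [0..<m]" for n m
    using upt_add_eq_append[of 0 n m] by (simp add: map_add_upt add.commute)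
  then show ?thesis
    by (simp add: word_def reading_def rev_map juxtapose_def comp_def cong: map_cong)
qed

section \<open>Composition\<close>

definition stack :: "nat \<Rightarrow> nat \<Rightarrow> nat \<Rightarrow> (pt \<Rightarrow> nat) \<Rightarrow> (pt \<Rightarrow> nat)
    \<Rightarrow> ((nat \<times> nat) \<times> (nat \<times> nat)) set" where
  "stack k l m f g =
     {(pp_top x, pp_top y) | x y. x \<in> pp_points k l \<and> y \<in> pp_points k l \<and> f x = f y} \<union>
     {(pp_bot x, pp_bot y) | x y. x \<in> pp_points l m \<and> y \<in> pp_points l m \<and> g x = g y}"

fun outer_pt :: "pt \<Rightarrow> nat \<times> nat" where
  "outer_pt (Up i) = (0, i)"
| "outer_pt (Lo i) = (2, i)"

lemma kernel_blocks_related: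
  "(\<exists>b \<in> (\<lambda>b. \<phi> ` b) ` kernel_blocks A f. x \<in> b \<and> y \<in> b) \<longleftrightarrow>
     (\<exists>x' y'. x = \<phi> x' \<and> y = \<phi> y' \<and> x' \<in> A \<and> y' \<in> A \<and> f x' = f y')" (is "?L \<longleftrightarrow> ?R")
proof
  assume ?R
  then obtain x' y' where "x = \<phi> x'" "y = \<phi> y'" "x' \<in> A" "y' \<in> A" "f x' = f y'" by blast
  then show ?L
    by (intro bexI[of _ "\<phi> ` {z \<in> A. f z = f y'}"]) (auto simp: kernel_blocks_def)
qed (fastforce simp: kernel_blocks_def)

text \<open>A composition is computed by labelling the stacked picture: \<open>c\<close> has to be
  constant along the blocks of both partitions and to separate connected components on the outer
  points. Every use supplies its own \<open>c\<close>.\<close>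

lemma pp_comp_kernel_part:
  assumes const: "\<And>x y. (x, y) \<in> stack k l m f g \<Longrightarrow> c x = c y"
    and sep: "\<And>x y. x \<in> pp_points k m \<Longrightarrow> y \<in> pp_points k m \<Longrightarrow>
      c (outer_pt x) = c (outer_pt y) \<Longrightarrow> (outer_pt x, outer_pt y) \<in> (stack k l m f g)\<^sup>*"
  shows "pp_comp (kernel_part k l f) (kernel_part l m g) = kernel_part k m (c \<circ> outer_pt)"
proof -
  let ?R = "(stack k l m f g)\<^sup>*"
  let ?O = "{(0, i) | i. i < k} \<union> {(2::nat, i) | i. i < m}"
  have conn: "{(x, y). \<exists>b \<in> (\<lambda>b. pp_top ` b) ` kernel_blocks (pp_points k l) f \<union>
      (\<lambda>b. pp_bot ` b) ` kernel_blocks (pp_points l m) g. x \<in> b \<and> y \<in> b} = stack k l m f g"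
    unfolding stack_def
    using kernel_blocks_related[of pp_top "pp_points k l" f] kernel_blocks_related[of pp_bot "pp_points l m" g]
    by (simp only: bex_Un) blast
  have "{(0, i) | i. i < k} = outer_pt ` {Up i | i. i < k}"
    and "{(2, i) | i. i < m} = outer_pt ` {Lo i | i. i < m}"
    by (force simp: image_iff)+
  then have outer: "?O = outer_pt ` pp_points k m"
    by (simp add: pp_points_def image_Un)
  have constR: "c x = c y" if "(x, y) \<in> ?R" for x y
    using that by (induction rule: rtrancl_induct) (auto dest: const)
  have cls: "pp_back ` ({y. (outer_pt x, y) \<in> ?R} \<inter> ?O)
      = {y \<in> pp_points k m. c (outer_pt y) = c (outer_pt x)}" if x: "x \<in> pp_points k m" for x
  proof -
    have "{y. (outer_pt x, y) \<in> ?R} \<inter> ?O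
        = outer_pt ` {y \<in> pp_points k m. c (outer_pt y) = c (outer_pt x)}"
      unfolding outer using sep[OF x] constR by fastforce
    moreover have "pp_back (outer_pt y) = y" for y by (cases y) auto
    ultimately show ?thesis by (simp add: image_image)
  qed
  have "{h x | x. x \<in> ?O} = (\<lambda>x. h (outer_pt x)) ` pp_points k m" for h :: "_ \<Rightarrow> pt set"
    unfolding outer by blast
  then have "{pp_back ` ({y. (x, y) \<in> ?R} \<inter> ?O) | x. x \<in> ?O}
      = (\<lambda>x. pp_back ` ({y. (outer_pt x, y) \<in> ?R} \<inter> ?O)) ` pp_points k m" .
  also have "\<dots> = kernel_blocks (pp_points k m) (c \<circ> outer_pt)"
    unfolding kernel_blocks_def by (intro image_cong) (simp_all add: cls)
  finally show ?thesis
    unfolding pp_comp_def kernel_part_def by (simp add: conn Let_def)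
qed

lemma length_word [simp]: "length (word k l f) = k + l"
  by (simp add: word_def reading_def)

lemma word_case_pt: "word (length w) 0 (case_pt (nth w) g) = w"
  by (simp add: word_def reading_def comp_def map_nth)

text \<open>The labels are chosen to give the words in \<open>special_words\<close>; the label
  \<open>1 - j\<close> reflects that the lower row is read from right to left.\<close>

lemma special_kernel_parts:
  "pp_pair = kernel_part 0 2 (\<lambda>_. 0)"
  "pp_id = kernel_part 1 1 (\<lambda>_. 0)"
  "pp_b4 = kernel_part 0 4 (\<lambda>_. 0)"
  "pp_dsing = kernel_part 0 2 (case_pt (\<lambda>_. 0) (\<lambda>j. 1 - j))"
  "pp_rho = kernel_part 3 3 (case_pt (\<lambda>i. if i = 2 then 1 else 0) (\<lambda>j. if j = 0 then 1 else 0))"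
proof -
  have pts: "pp_points 0 2 = {Lo 0, Lo 1}" "pp_points 1 1 = {Up 0, Lo 0}"
    "pp_points 0 4 = {Lo 0, Lo 1, Lo 2, Lo 3}"
    "pp_points 3 3 = {Up 0, Up 1, Up 2, Lo 0, Lo 1, Lo 2}"
    unfolding pp_points_def by (auto simp: less_Suc_eq numeral_eq_Suc)
  show "pp_pair = kernel_part 0 2 (\<lambda>_. 0)"
    "pp_id = kernel_part 1 1 (\<lambda>_. 0)"
    "pp_b4 = kernel_part 0 4 (\<lambda>_. 0)"
    "pp_dsing = kernel_part 0 2 (case_pt (\<lambda>_. 0) (\<lambda>j. 1 - j))"
    by (auto simp: pp_pair_def pp_id_def pp_b4_def pp_dsing_def kernel_part_def kernel_blocks_def pts
        pts(2)[unfolded One_nat_def])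
  let ?f = "case_pt (\<lambda>i. if i = 2 then 1 else 0) (\<lambda>j. if j = 0 then 1 else 0) :: pt \<Rightarrow> nat"
  have "{y \<in> pp_points 3 3. ?f y = 0} = {Up 0, Up 1, Lo 1, Lo 2}"
    "{y \<in> pp_points 3 3. ?f y = Suc 0} = {Up 2, Lo 0}"
    unfolding pts by auto
  then show "pp_rho = kernel_part 3 3 ?f"
    unfolding pp_rho_def kernel_part_def kernel_blocks_def by (simp add: pts insert_commute)
qed

section \<open>Categories of partitions and their words\<close>

lemma upt_small: "[0..<2] = [0, 1]" "[0..<3] = [0, 1, 2]" "[0..<4] = [0, 1, 2, 3]"
  by (simp_all add: upt_rec)

lemma special_words:
  "word 0 2 (\<lambda>_. 0) = [0, 0]"
  "word 1 1 (\<lambda>_. 0) = [0, 0]"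
  "word 0 4 (\<lambda>_. 0) = [0, 0, 0, 0]"
  "word 0 2 (case_pt (\<lambda>_. 0) (\<lambda>j. 1 - j)) = [0, 1]"
  "word 3 3 (case_pt (\<lambda>i. if i = 2 then 1 else 0) (\<lambda>j. if j = 0 then 1 else 0))
     = [0, 0, 1, 0, 0, 1]"
  by (simp_all add: word_def reading_def upt_small)

definition words_of :: "partition set \<Rightarrow> nat list set" where
  "words_of C = {w. word_part w \<in> C}"

definition parts_of :: "nat list set \<Rightarrow> partition set" where
  "parts_of K = {kernel_part k l f | k l f. word k l f \<in> K}"

lemma block_of_mem:
  assumes "pp_valid p" "x \<in> pp_points (pp_upper p) (pp_lower p)"
  shows "(THE b. b \<in> pp_blocks p \<and> x \<in> b) \<in> pp_blocks p"
proof -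
  obtain k l B where p: "p = (k, l, B)" by (cases p)
  have un: "\<Union>B = pp_points k l"
    and dj: "\<And>b c. b \<in> B \<Longrightarrow> c \<in> B \<Longrightarrow> b \<noteq> c \<Longrightarrow> b \<inter> c = {}"
    using assms(1) by (auto simp: pp_valid_def p)
  have "x \<in> \<Union>B" using assms(2) by (simp add: un p pp_upper_def pp_lower_def)
  then obtain b where b: "b \<in> B" "x \<in> b" by blast
  then have "(THE b. b \<in> B \<and> x \<in> b) = b" using dj by (intro the_equality) blast+
  with b show ?thesis by (simp add: p pp_blocks_def)
qed

section \<open>From a category to its words\<close>

locale partition_category =
  fixes C :: "partition set"
  assumes category: "category_of_partitions C"
begin

lemma valid: "p \<in> C \<Longrightarrow> pp_valid p"
  and pair: "pp_pair \<in> C"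
  and tensor: "p \<in> C \<Longrightarrow> q \<in> C \<Longrightarrow> pp_tensor p q \<in> C"
  and comp: "p \<in> C \<Longrightarrow> q \<in> C \<Longrightarrow> pp_lower p = pp_upper q \<Longrightarrow> pp_comp p q \<in> C"
  and star: "p \<in> C \<Longrightarrow> pp_star p \<in> C"
  and rotUL: "p \<in> C \<Longrightarrow> 1 \<le> pp_upper p \<Longrightarrow> pp_rotUL p \<in> C"
  and rotUR: "p \<in> C \<Longrightarrow> 1 \<le> pp_upper p \<Longrightarrow> pp_rotUR p \<in> C"
  and rotLR: "p \<in> C \<Longrightarrow> 1 \<le> pp_lower p \<Longrightarrow> pp_rotLR p \<in> C"
  using category by (auto simp: category_of_partitions_def)

text \<open>Right rotations lift the lower points one by one without changing the word, until the
  representative \<open>word_part\<close> without lower points is reached.\<close>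

lemma kernel_part_mem_iff: "kernel_part k l f \<in> C \<longleftrightarrow> word k l f \<in> words_of C"
proof (induction l arbitrary: k f)
  case 0
  have "kernel_part k 0 f = word_part (word k 0 f)"
    unfolding word_part_def length_word add_0_right
  proof (rule kernel_part_cong)
    fix x assume "x \<in> pp_points k 0"
    then show "f x = case_pt (nth (word k 0 f)) (\<lambda>_. 0) x"
      by (cases x) (auto simp: word_def reading_def)
  qed
  then show ?case by (simp add: words_of_def)
next
  case (Suc l)
  have "f x = (f \<circ> pp_rotUR_map (Suc k) l \<circ> pp_rotLR_map k (Suc l)) x" if "x \<in> pp_points k (Suc l)" for x
    using rotUR_LR(1)[OF that] by simp
  then have "kernel_part k (Suc l) f = pp_rotUR (kernel_part (Suc k) l (f \<circ> pp_rotUR_map (Suc k) l))"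
    unfolding pp_rotUR_kernel_part by (rule kernel_part_cong)
  then have "kernel_part k (Suc l) f \<in> C" if "kernel_part (Suc k) l (f \<circ> pp_rotUR_map (Suc k) l) \<in> C"
    using rotUR[OF that] by simp
  moreover have "kernel_part (Suc k) l (f \<circ> pp_rotUR_map (Suc k) l) \<in> C" if "kernel_part k (Suc l) f \<in> C"
    using rotLR[OF that] by (simp add: pp_rotLR_kernel_part)
  ultimately have "kernel_part k (Suc l) f \<in> C \<longleftrightarrow> kernel_part (Suc k) l (f \<circ> pp_rotUR_map (Suc k) l) \<in> C"
    by blast
  then show ?case unfolding Suc.IH word_rotLR .
qed

lemma parts_of_words_of: "parts_of (words_of C) = C"
  using valid valid_ex_kernel_part by (fastforce simp: parts_of_def kernel_part_mem_iff)

lemma words_of_inj_map: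
  assumes "w \<in> words_of C" "inj_on f (set w)"
  shows "map f w \<in> words_of C"
proof -
  have "word_part (map f w) = word_part w"
    unfolding word_part_def using assms(2)
    by (auto simp: kernel_part_eq_iff pp_points_def inj_on_eq_iff)
  with assms(1) show ?thesis by (simp add: words_of_def)
qed

lemma words_of_rotate1: "a # w \<in> words_of C \<Longrightarrow> w @ [a] \<in> words_of C"
proof -
  assume "a # w \<in> words_of C"
  then have "kernel_part (Suc (length w)) 0 (case_pt (nth (a # w)) (\<lambda>_. 0)) \<in> C"
    by (simp add: words_of_def word_part_def)
  from rotUL[OF this]
  have "word (length w) (Suc 0) (case_pt (nth (a # w)) (\<lambda>_. 0) \<circ> pp_rotLU_map) \<in> words_of C"
    by (simp add: pp_rotUL_kernel_part kernel_part_mem_iff)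
  with word_rotUL[of "length w" 0 "case_pt (nth (a # w)) (\<lambda>_. 0)"] word_case_pt[of "a # w"]
  show ?thesis by auto
qed

lemma words_of_rotate: "u @ v \<in> words_of C \<Longrightarrow> v @ u \<in> words_of C"
proof (induction u arbitrary: v)
  case (Cons a u)
  from Cons.prems words_of_rotate1[of a "u @ v"] have "u @ (v @ [a]) \<in> words_of C" by simp
  from Cons.IH[OF this] show ?case by simp
qed simp

lemma words_of_rev:
  assumes "w \<in> words_of C"
  shows "rev w \<in> words_of C"
proof -
  let ?f = "case_pt (nth w) (\<lambda>_. 0)"
  from assms have "kernel_part (length w) 0 ?f \<in> C"
    by (simp add: words_of_def word_part_def)
  from star[OF this] have "word 0 (length w) (?f \<circ> pp_flip) \<in> words_of C"
    by (simp add: pp_star_kernel_part kernel_part_mem_iff)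
  then show ?thesis by (simp add: word_star word_case_pt)
qed

lemma words_of_append:
  assumes "u \<in> words_of C" "v \<in> words_of C" "set u \<inter> set v = {}"
  shows "u @ v \<in> words_of C"
proof -
  let ?f = "\<lambda>w. case_pt (nth w) (\<lambda>_. 0)"
  from assms tensor
  have "pp_tensor (kernel_part (length u) 0 (?f u)) (kernel_part (length v) 0 (?f v)) \<in> C"
    by (simp add: words_of_def word_part_def)
  then have "word (length u + length v) (0 + 0) (juxtapose (length u) 0 (?f u) (?f v)) \<in> words_of C"
    using assms(3) by (simp add: pp_tensor_kernel_part word_case_pt kernel_part_mem_iff)
  then show ?thesis
    unfolding word_juxtapose by (simp add: word_case_pt comp_def map_nth)
qed

lemma words_of_cap:
  assumes "w @ [a, b] \<in> words_of C"
  shows "map (subst1 b a) w \<in> words_of C"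
proof -
  let ?n = "length w"
  \<comment> \<open>Lower point 0 is read last and hence bears \<open>b\<close>.\<close>
  define f where "f = case_pt (nth w) (\<lambda>j. if j = 0 then b else a)"
  \<comment> \<open>The cap joins the blocks of \<open>a\<close> and \<open>b\<close>; the merged
    component is called \<open>a\<close>, and so are both middle points.\<close>
  define c where "c = (\<lambda>(t, i). if t = (0::nat) then subst1 b a (w ! i) else a)"
  let ?S = "stack ?n 2 0 f (\<lambda>_. 0)"
  have "word ?n 2 f = w @ [a, b]"
    by (simp add: word_def reading_def f_def comp_def map_nth upt_small)
  with assms have p: "kernel_part ?n 2 f \<in> C" by (simp add: kernel_part_mem_iff)
  have q: "kernel_part 2 0 (\<lambda>_. 0) \<in> C"
    using star[OF pair] by (simp add: special_kernel_parts pp_star_kernel_part comp_def)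
  have stack_top: "(pp_top x, pp_top y) \<in> ?S"
    if "x \<in> pp_points ?n 2" "y \<in> pp_points ?n 2" "f x = f y" for x y
    using that by (auto simp: stack_def)
  have up_up: "((0, i), (0, j)) \<in> ?S" if "i < ?n" "j < ?n" "w ! i = w ! j" for i j
    using stack_top[of "Up i" "Up j"] that by (simp add: f_def)
  have up_a: "((0, i), (1, 1)) \<in> ?S \<and> ((1, 1), (0, i)) \<in> ?S" if "i < ?n" "w ! i = a" for i
    using stack_top[of "Up i" "Lo 1"] stack_top[of "Lo 1" "Up i"] that by (simp add: f_def)
  have up_b: "((0, i), (1, 0)) \<in> ?S \<and> ((1, 0), (0, i)) \<in> ?S" if "i < ?n" "w ! i = b" for i
    using stack_top[of "Up i" "Lo 0"] stack_top[of "Lo 0" "Up i"] that by (simp add: f_def)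
  have "(pp_bot x, pp_bot y) \<in> ?S" if "x \<in> pp_points 2 0" "y \<in> pp_points 2 0" for x y
    using that by (auto simp: stack_def)
  from this[of "Up 0" "Up 1"] this[of "Up 1" "Up 0"]
  have mid: "((1, 0), (1, 1)) \<in> ?S" "((1, 1), (1, 0)) \<in> ?S"
    by simp_all
  have up_path: "((0, i), (0, j)) \<in> ?S\<^sup>*"
    if ij: "i < ?n" "j < ?n" "subst1 b a (w ! i) = subst1 b a (w ! j)" for i j
  proof -
    \<comment> \<open>In the two mixed cases the path descends to one middle point, crosses the cap,
      and climbs from the other.\<close>
    consider "w ! i = w ! j" | "w ! i = a" "w ! j = b" | "w ! i = b" "w ! j = a"
      using ij(3) unfolding subst1_def by metis
    then show ?thesis
    proof cases
      case 1 with up_up that show ?thesis by blast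
    next
      case 2
      with up_a[of i] up_b[of j] mid that show ?thesis
        by (meson converse_rtrancl_into_rtrancl r_into_rtrancl)
    next
      case 3
      with up_b[of i] up_a[of j] mid that show ?thesis
        by (meson converse_rtrancl_into_rtrancl r_into_rtrancl)
    qed
  qed
  have "pp_comp (kernel_part ?n 2 f) (kernel_part 2 0 (\<lambda>_. 0)) = kernel_part ?n 0 (c \<circ> outer_pt)"
  proof (rule pp_comp_kernel_part)
    fix x y assume "(x, y) \<in> ?S"
    then show "c x = c y"
      by (auto simp: stack_def pp_points_def c_def f_def subst1_def split: if_splits)
  next
    fix x y assume "x \<in> pp_points ?n 0" "y \<in> pp_points ?n 0" "c (outer_pt x) = c (outer_pt y)"
    then show "(outer_pt x, outer_pt y) \<in> ?S\<^sup>*"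
      using up_path by (cases x; cases y) (auto simp: c_def)
  qed
  with comp[OF p q] have "word ?n 0 (c \<circ> outer_pt) \<in> words_of C"
    by (simp add: kernel_part_mem_iff)
  moreover have "word ?n 0 (c \<circ> outer_pt) = map (subst1 b a) w"
    by (rule nth_equalityI) (simp_all add: word_def reading_def c_def)
  ultimately show ?thesis by simp
qed

lemma F_of_eq: "F_of C = {z2_red (map Suc w) | w. w \<in> words_of C}"
proof (intro equalityI subsetI)
  fix x assume "x \<in> F_of C"
  then obtain p lab where p: "p \<in> C" "pp_labelling p lab" and x: "x = z2_red (pp_word p lab)"
    by (auto simp: F_of_def)
  let ?k = "pp_upper p" and ?l = "pp_lower p"
  let ?g = "\<lambda>x. lab (THE b. b \<in> pp_blocks p \<and> x \<in> b)"
  have eq: "p = kernel_part ?k ?l ?g"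
    using p valid by (intro valid_eq_kernel_part) (auto simp: pp_labelling_def)
  have pos: "0 < ?g y" if y: "y \<in> pp_points ?k ?l" for y
    using block_of_mem[OF valid[OF p(1)] y] p(2) by (force simp: pp_labelling_def)
  \<comment> \<open>The letters of G start at 1, those of \<open>words_of\<close> at 0. As all
    labels are positive, subtracting 1 is injective on them and the kernel stays the same.\<close>
  let ?h = "\<lambda>y. ?g y - 1"
  have "kernel_part ?k ?l ?h = kernel_part ?k ?l ?g"
    unfolding kernel_part_eq_iff
  proof (intro conjI refl ballI)
    fix x y assume "x \<in> pp_points ?k ?l" "y \<in> pp_points ?k ?l"
    from this[THEN pos] show "?h x = ?h y \<longleftrightarrow> ?g x = ?g y" by arith
  qed
  moreover have "kernel_part ?k ?l ?g \<in> C" by (subst eq[symmetric]) (rule p(1))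
  ultimately have mem: "word ?k ?l ?h \<in> words_of C" by (simp only: kernel_part_mem_iff[symmetric])
  have "map Suc (word ?k ?l ?h) = pp_word p lab"
    unfolding pp_word_eq word_def using pos by simp
  with x have "x = z2_red (map Suc (word ?k ?l ?h))" by (simp only:)
  with mem show "x \<in> {z2_red (map Suc w) | w. w \<in> words_of C}" by blast
next
  fix x assume "x \<in> {z2_red (map Suc w) | w. w \<in> words_of C}"
  then obtain w where w: "w \<in> words_of C" "x = z2_red (map Suc w)" by auto
  let ?f = "Suc \<circ> case_pt (nth w) (\<lambda>_. 0)"
  have word: "word (length w) 0 ?f = map Suc w"
    using word_case_pt[of w "\<lambda>_. 0"] by (simp add: word_def flip: map_map)
  with w(1) words_of_inj_map have "kernel_part (length w) 0 ?f \<in> C"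
    by (simp add: kernel_part_mem_iff)
  moreover obtain lab where "pp_labelling (kernel_part (length w) 0 ?f) lab"
      "pp_word (kernel_part (length w) 0 ?f) lab = map Suc w"
    using ex_labelling[of "length w" 0 ?f] word by auto
  ultimately show "x \<in> F_of C" unfolding F_of_def w(2) mem_Collect_eq by metis
qed

end

lemma words_of_simpl_hyperoctahedral:
  assumes "simpl_hyperoctahedral C"
  shows "letter_invariant (words_of C)" "[0, 1] \<notin> words_of C"
proof -
  have C: "category_of_partitions C" "pp_b4 \<in> C" "pp_dsing \<notin> C" "pp_rho \<in> C"
    using assms by (auto simp: simpl_hyperoctahedral_def hyperoctahedral_def)
  interpret partition_category C by standard fact
  show "[0, 1] \<notin> words_of C"
    using C(3) by (simp only: special_kernel_parts kernel_part_mem_iff special_words not_False_eq_True)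
  have "[0, 0] \<in> words_of C" "[0, 0, 0, 0] \<in> words_of C" "[0, 0, 1, 0, 0, 1] \<in> words_of C"
    using pair C(2,4) by (simp_all only: special_kernel_parts kernel_part_mem_iff special_words)
  then interpret simplifiable_words "words_of C"
    using words_of_inj_map words_of_rotate words_of_rev words_of_append words_of_cap
    by unfold_locales auto
  show "letter_invariant (words_of C)" ..
qed

section \<open>From a letter-invariant set of words to a category\<close>

context letter_invariant
begin

text \<open>Two labellings with the same kernel have words that are letter maps of each other, so
  membership does not depend on the labelling chosen.\<close>

lemma kernel_part_mem_parts_of: "kernel_part k l f \<in> parts_of K \<longleftrightarrow> word k l f \<in> K"
proof
  assume "kernel_part k l f \<in> parts_of K"
  then obtain g where g: "kernel_part k l f = kernel_part k l g" "word k l g \<in> K"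
    unfolding parts_of_def by (auto simp: kernel_part_eq_iff)
  then obtain h where "word k l f = map h (word k l g)"
    using word_factor[of k l g f] by (auto simp: kernel_part_eq_iff)
  with g(2) map_closed show "word k l f \<in> K" by simp
qed (auto simp: parts_of_def)

lemma words_of_parts_of: "words_of (parts_of K) = K"
  unfolding words_of_def word_part_def by (simp add: kernel_part_mem_parts_of word_case_pt)

lemma parts_of_tensor:
  assumes "word k l f \<in> K" "word k' l' g \<in> K"
  shows "pp_tensor (kernel_part k l f) (kernel_part k' l' g) \<in> parts_of K"
proof -
  obtain N where N: "\<And>x. x \<in> set (word k l f) \<Longrightarrow> x < N"
    using finite_nat_set_iff_bounded[of "set (word k l f)"] by auto
  let ?g = "\<lambda>x. g x + N"
  have g: "kernel_part k' l' g = kernel_part k' l' ?g" by (simp add: kernel_part_eq_iff)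
  have "word k' l' ?g = map (\<lambda>x. x + N) (word k' l' g)" by (simp add: word_def)
  then have g': "word k' l' ?g \<in> K" using assms(2) map_closed by simp
  have "set (word k l f) \<inter> set (word k' l' ?g) = {}"
    using N by (force simp: set_word)
  note t = pp_tensor_kernel_part[OF this]
  let ?u = "map f (map Up [0..<k])" and ?v = "map f (map Lo (rev [0..<l]))"
  have "?u @ ?v \<in> K" using assms(1) by (simp add: word_def reading_def)
  \<comment> \<open>Rotation places the two halves of the first word next to each other, so that the
    second word can be appended; rotating back puts it in the middle.\<close>
  then have "?v @ ?u \<in> K" by (rule rotate_closed)
  with g' have "(?v @ ?u) @ word k' l' ?g \<in> K" by (rule append_closed[rotated])
  then have "?u @ word k' l' ?g @ ?v \<in> K"
    using rotate_closed[of ?v "?u @ word k' l' ?g"] by simp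
  then show ?thesis
    unfolding g t kernel_part_mem_parts_of word_juxtapose .
qed

lemma parts_of_comp:
  assumes "word k l f \<in> K" "word l m g \<in> K"
  shows "pp_comp (kernel_part k l f) (kernel_part l m g) \<in> parts_of K"
proof -
  let ?S = "stack k l m f g"
  \<comment> \<open>A canonical label for the component of \<open>x\<close>: the least code of a
    point connected to it.\<close>
  define c where "c x = (LEAST n. (x, prod_decode n) \<in> ?S\<^sup>*)" for x
  have "sym ?S"
    unfolding stack_def
    by (intro sym_Un symI; clarify; metis)
  then have sym: "sym (?S\<^sup>*)" by (rule sym_rtrancl)
  have c_eq: "c x = c y" if "(x, y) \<in> ?S\<^sup>*" for x y
  proof -
    have "(x, z) \<in> ?S\<^sup>* \<longleftrightarrow> (y, z) \<in> ?S\<^sup>*" for z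
      using that symD[OF sym that] rtrancl_trans by metis
    then show ?thesis by (simp add: c_def)
  qed
  have c_mem: "(x, prod_decode (c x)) \<in> ?S\<^sup>*" for x
    unfolding c_def
    by (rule LeastI[of "\<lambda>n. (x, prod_decode n) \<in> ?S\<^sup>*" "prod_encode x"]) simp
  have c_sep: "(x, y) \<in> ?S\<^sup>*" if "c x = c y" for x y
    using c_mem[of x] symD[OF sym c_mem[of y]] that rtrancl_trans by metis
  have comp: "pp_comp (kernel_part k l f) (kernel_part l m g) = kernel_part k m (c \<circ> outer_pt)"
    by (rule pp_comp_kernel_part) (auto intro: c_eq c_sep)
  let ?u = "map (\<lambda>i. c (0, i)) [0..<k]" and ?s = "map (\<lambda>i. c (1, i)) [0..<l]"
    and ?v = "map (\<lambda>i. c (2, i)) (rev [0..<m])"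
  have top: "c (pp_top x) = c (pp_top y)"
    if "x \<in> pp_points k l" "y \<in> pp_points k l" "f x = f y" for x y
    using that by (intro c_eq r_into_rtrancl) (auto simp: stack_def)
  have "\<exists>h. word k l (\<lambda>x. c (pp_top x)) = map h (word k l f)"
    by (intro word_factor top)
  then obtain h where "word k l (\<lambda>x. c (pp_top x)) = map h (word k l f)" ..
  with map_closed[OF assms(1), of h] have "word k l (\<lambda>x. c (pp_top x)) \<in> K" by simp
  then have "?u @ rev ?s \<in> K"
    by (simp add: word_def reading_def comp_def rev_map)
  moreover
  have bot: "c (pp_bot x) = c (pp_bot y)"
    if "x \<in> pp_points l m" "y \<in> pp_points l m" "g x = g y" for x y
    using that by (intro c_eq r_into_rtrancl) (auto simp: stack_def)
  have "\<exists>h. word l m (\<lambda>x. c (pp_bot x)) = map h (word l m g)"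
    by (intro word_factor bot)
  then obtain h' where "word l m (\<lambda>x. c (pp_bot x)) = map h' (word l m g)" ..
  with map_closed[OF assms(2), of h'] have "word l m (\<lambda>x. c (pp_bot x)) \<in> K" by simp
  then have "?s @ ?v \<in> K"
    by (simp add: word_def reading_def comp_def)
  \<comment> \<open>The middle row is read backwards in the upper word and forwards in the lower
    one, so its letters cancel.\<close>
  ultimately have "(?u @ rev ?s) @ (?s @ ?v) \<in> K" by (rule append_closed)
  then have "?u @ ?v \<in> K" by (simp only: append_assoc cancel_rev_iff)
  then have "word k m (c \<circ> outer_pt) \<in> K"
    by (simp add: word_def reading_def comp_def)
  with comp show ?thesis by (simp add: kernel_part_mem_parts_of)
qed

lemma simpl_hyperoctahedral_parts_of:
  assumes "[0, 1] \<notin> K"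
  shows "simpl_hyperoctahedral (parts_of K)"
proof -
  have sq: "[a, a] \<in> K" for a using cancel_iff[of "[]" a "[]"] Nil_mem by simp
  have "[0, 0, 0, 0] \<in> K" using append_closed[OF sq sq] by simp
  moreover have "[0, 0, 1, 0, 0, 1] \<in> K"
    using cancel_iff[of "[0,0,1]" 0 "[1]"] cancel_iff[of "[]" 0 "[1,1]"] sq by simp
  ultimately have mem: "pp_pair \<in> parts_of K" "pp_id \<in> parts_of K" "pp_b4 \<in> parts_of K"
      "pp_rho \<in> parts_of K" "pp_dsing \<notin> parts_of K"
    using sq[of 0] assms
    by (simp_all only: special_kernel_parts kernel_part_mem_parts_of special_words not_False_eq_True)
  have ex: "\<exists>k l f. p = kernel_part k l f \<and> word k l f \<in> K" if "p \<in> parts_of K" for p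
    using that by (auto simp: parts_of_def)
  have "pp_valid p" if "p \<in> parts_of K" for p
    using ex[OF that] pp_valid_kernel_part by auto
  moreover have "pp_tensor p q \<in> parts_of K" if "p \<in> parts_of K" "q \<in> parts_of K" for p q
    using ex[OF that(1)] ex[OF that(2)] parts_of_tensor by auto
  moreover have "pp_comp p q \<in> parts_of K"
    if "p \<in> parts_of K" "q \<in> parts_of K" "pp_lower p = pp_upper q" for p q
    using ex[OF that(1)] ex[OF that(2)] that(3) parts_of_comp by auto
  moreover have "pp_star p \<in> parts_of K" if "p \<in> parts_of K" for p
    using ex[OF that] rev_closed
    by (auto simp: pp_star_kernel_part kernel_part_mem_parts_of word_star)
  moreover have "pp_rotUL p \<in> parts_of K \<and> pp_rotUR p \<in> parts_of K"
    if p: "p \<in> parts_of K" "1 \<le> pp_upper p" for p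
  proof -
    obtain k l f where f: "p = kernel_part (Suc k) l f" "word (Suc k) l f \<in> K"
      using ex[OF p(1)] p(2) by (metis Suc_le_D One_nat_def kernel_part_simps(1))
    then show ?thesis
      using word_rotUL[of k l f] rotate_closed[of "[_]"]
      by (auto simp: pp_rotUL_kernel_part pp_rotUR_kernel_part kernel_part_mem_parts_of word_rotUR)
  qed
  moreover have "pp_rotLU p \<in> parts_of K \<and> pp_rotLR p \<in> parts_of K"
    if p: "p \<in> parts_of K" "1 \<le> pp_lower p" for p
  proof -
    obtain k l f where f: "p = kernel_part k (Suc l) f" "word k (Suc l) f \<in> K"
      using ex[OF p(1)] p(2) by (metis Suc_le_D One_nat_def kernel_part_simps(2))
    then show ?thesis
      using word_rotLU[of k l f] rotate_closed[of _ "[_]"]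
      by (auto simp: pp_rotLU_kernel_part pp_rotLR_kernel_part kernel_part_mem_parts_of word_rotLR)
  qed
  ultimately show ?thesis
    using mem
    by (simp add: simpl_hyperoctahedral_def hyperoctahedral_def category_of_partitions_def)
qed

end

section \<open>Words and the free group\<close>

definition expand :: "(bool \<times> nat) list \<Rightarrow> nat list" where
  "expand w = concat (map (\<lambda>(b, k). if b then [k, 0] else [0, k]) w)"

text \<open>In a word of even length, \<open>a_p a_q = x_p\<^sup>-\<^sup>1 x_q\<close> with \<open>x_0 = e\<close>, so the exponents alternate in
  sign and the letter 0 is dropped; the Boolean is the sign of the current position.\<close>

fun compress :: "bool \<Rightarrow> nat list \<Rightarrow> (bool \<times> nat) list" where
  "compress s [] = []"
| "compress s (a # w) = (if a = 0 then [] else [(s, a)]) @ compress (\<not> s) w"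

abbreviation positive :: "(bool \<times> nat) list \<Rightarrow> bool" where
  "positive w \<equiv> \<forall>x\<in>set w. 0 < snd x"

lemma expand_simps [simp]:
  "expand [] = []" "expand (x # w) = (if fst x then [snd x, 0] else [0, snd x]) @ expand w"
  "expand (u @ v) = expand u @ expand v"
  by (auto simp: expand_def case_prod_beta)

lemma iota_eq: "iota w = z2_red (map Suc (expand w))"
proof -
  have "concat (map (\<lambda>(b, k). if b then [k + 1, 1] else [1, k + 1]) w) = map Suc (expand w)"
    by (induction w) auto
  then show ?thesis by (simp add: iota_def)
qed

lemma even_length_expand: "even (length (expand w))"
  by (induction w) auto

lemma expand_fg_inv: "expand (fg_inv w) = rev (expand w)"
  by (induction w) (auto simp: fg_inv_def)

lemma compress_append:
  "compress s (u @ v) = compress s u @ compress (if even (length u) then s else \<not> s) v"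
  by (induction u arbitrary: s) auto

lemma compress_Not: "compress (\<not> s) w = map flip (compress s w)"
proof (induction w arbitrary: s)
  case (Cons a w)
  show ?case using Cons.IH[of "\<not> s"] by simp
qed simp

lemma compress_rev:
  "compress s (rev w) = rev (compress (if even (length w) then \<not> s else s) w)"
  by (induction w arbitrary: s) (auto simp: compress_append)

lemma positive_compress: "positive (compress s w)"
  by (induction w arbitrary: s) auto

lemma compress_expand: "positive w \<Longrightarrow> compress True (expand w) = w"
  by (induction w) auto

text \<open>Adjacent positions carry opposite signs, so a square becomes an inverse pair, or nothing
  when the letter is 0.\<close>

lemma fg_red_compress_cancel: "fg_red (compress s (u @ [a, a] @ v)) = fg_red (compress s (u @ v))"
proof -
  let ?t = "if even (length u) then s else \<not> s"
  show ?thesis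
    using fg.red_cancel[of "compress s u" "(?t, a)" "compress ?t v"]
    by (cases "even (length u)") (simp_all add: compress_append fg_red_eq)
qed

text \<open>Two letters at a time: for nonzero \<open>p\<close> and \<open>q\<close>,
  \<open>[p, q]\<close> compresses to x_p^-1 x_q, which expands to \<open>[p, 0, 0, q]\<close>; if a
  letter is 0, its factor is missing.\<close>

lemma z2_red_expand_compress:
  "even (length w) \<Longrightarrow> z2_red (expand (compress True w)) = z2_red w"
proof (induction w rule: induct_list012)
  case (3 x y w)
  then have IH: "z2_red (expand (compress True w)) = z2_red w" by simp
  have "z2_red (expand (compress True [x, y])) = z2_red [x, y]"
    by (auto simp: z2_red_def)
  then show ?case
    using z2.red_append_cong[of "expand (compress True [x, y])" "[x, y]" "expand (compress True w)" w]
      IH compress_append[of True "[x, y]" w]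
    by (simp add: z2_red_eq)
qed simp_all

section \<open>The group of reduced words and its endomorphisms\<close>

lemma carrier_free_grp: "w \<in> carrier free_grp \<longleftrightarrow> fg.reduced w \<and> positive w"
  by (auto simp: free_grp_def fg_reduced_iff Suc_le_eq)

lemma fg_red_carrier: "positive w \<Longrightarrow> fg_red w \<in> carrier free_grp"
  using fg.reduced_red[of w] fg.set_red[of w] by (auto simp: carrier_free_grp fg_red_eq)

lemma fg_red_append_carrier:
  "u \<in> carrier free_grp \<Longrightarrow> v \<in> carrier free_grp \<Longrightarrow> fg_red (u @ v) \<in> carrier free_grp"
  by (rule fg_red_carrier) (auto simp: carrier_free_grp)

lemma fg_red_id: "w \<in> carrier free_grp \<Longrightarrow> fg_red w = w"
  by (simp add: carrier_free_grp fg_red_eq fg.red_reduced)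

lemma positive_fg_inv [simp]: "positive (fg_inv w) \<longleftrightarrow> positive w"
  by (auto simp: fg_inv_def case_prod_beta)

lemma fg_inv_fg_red: "fg_red (fg_inv (fg_red w)) = fg_red (fg_inv w)"
proof -
  have "cred flip (rev (map flip (u @ [a, flip a] @ v))) = cred flip (rev (map flip (u @ v)))" for u a v
    using fg.red_cancel[of "rev (map flip v)" a "rev (map flip u)"] by simp
  then show ?thesis
    unfolding fg_inv_eq fg_red_eq by (rule fg.red_invariant)
qed

lemma free_grp_simps [simp]:
  "x \<otimes>\<^bsub>free_grp\<^esub> y = fg_red (x @ y)" "\<one>\<^bsub>free_grp\<^esub> = []"
  by (simp_all add: free_grp_def)

lemma group_free_grp: "group free_grp"
proof (rule groupI)
  fix x y z assume xyz: "x \<in> carrier free_grp" "y \<in> carrier free_grp" "z \<in> carrier free_grp"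
  show "x \<otimes>\<^bsub>free_grp\<^esub> y \<in> carrier free_grp"
    using xyz by (simp add: fg_red_append_carrier)
  show "x \<otimes>\<^bsub>free_grp\<^esub> y \<otimes>\<^bsub>free_grp\<^esub> z = x \<otimes>\<^bsub>free_grp\<^esub> (y \<otimes>\<^bsub>free_grp\<^esub> z)"
    by (simp add: fg_red_eq fg.red_append_red fg.red_red_append)
next
  fix x assume x: "x \<in> carrier free_grp"
  show "\<one>\<^bsub>free_grp\<^esub> \<otimes>\<^bsub>free_grp\<^esub> x = x" using x by (simp add: fg_red_id)
  have "fg_red (fg_inv x) \<in> carrier free_grp"
    using x by (intro fg_red_carrier) (simp add: carrier_free_grp)
  moreover have "fg_red (fg_red (fg_inv x) @ x) = []"
    by (simp add: fg_red_eq fg.red_red_append fg_inv_eq fg.red_inverse_left)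
  ultimately show "\<exists>y\<in>carrier free_grp. y \<otimes>\<^bsub>free_grp\<^esub> x = \<one>\<^bsub>free_grp\<^esub>" by auto
qed (simp add: free_grp_def fg_reduced_def)

lemma inv_free_grp: "x \<in> carrier free_grp \<Longrightarrow> inv\<^bsub>free_grp\<^esub> x = fg_red (fg_inv x)"
proof (rule group.inv_equality[OF group_free_grp])
  assume x: "x \<in> carrier free_grp"
  show "fg_red (fg_inv x) \<otimes>\<^bsub>free_grp\<^esub> x = \<one>\<^bsub>free_grp\<^esub>"
    by (simp add: fg_red_eq fg.red_red_append fg_inv_eq fg.red_inverse_left)
  show "fg_red (fg_inv x) \<in> carrier free_grp"
    using x by (intro fg_red_carrier) (simp add: carrier_free_grp)
qed

abbreviation fg_subst :: "(nat \<Rightarrow> (bool \<times> nat) list) \<Rightarrow> (bool \<times> nat) list \<Rightarrow> (bool \<times> nat) list" where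
  "fg_subst g w \<equiv> concat (map (\<lambda>(b, k). if b then fg_inv (g k) else g k) w)"

lemma fg_endo_fg_red: "fg_endo g (fg_red w) = fg_endo g w"
proof -
  have "cred flip (fg_subst g (u @ [a, flip a] @ v)) = cred flip (fg_subst g (u @ v))" for u a v
  proof -
    have "cred flip (fg_subst g [a, flip a]) = cred flip []"
      by (cases a) (auto simp: fg_inv_eq fg.red_inverse_left fg.red_inverse_right)
    from fg.red_append_cong[OF refl fg.red_append_cong[OF this refl]]
    have "cred flip (fg_subst g u @ fg_subst g [a, flip a] @ fg_subst g v)
        = cred flip (fg_subst g u @ [] @ fg_subst g v)" .
    then show ?thesis by simp
  qed
  then show ?thesis
    unfolding fg_endo_def fg_red_eq by (rule fg.red_invariant)
qed

lemma positive_fg_subst: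
  assumes "\<And>k. 0 < k \<Longrightarrow> positive (g k)" "positive w"
  shows "positive (fg_subst g w)"
  using assms(2)
proof (induction w)
  case (Cons x w)
  obtain b k where x: "x = (b, k)" by (cases x)
  show ?case using Cons assms(1)[of k] by (simp add: x ball_Un del: set_concat)
qed simp

definition subgroup_of_words :: "nat list set \<Rightarrow> (bool \<times> nat) list set" where
  "subgroup_of_words K = {x \<in> carrier free_grp. expand x \<in> K}"

definition words_of_subgroup :: "(bool \<times> nat) list set \<Rightarrow> nat list set" where
  "words_of_subgroup H = {w. even (length w) \<and> fg_red (compress True w) \<in> H}"

lemma z2_red_rev_cong:
  assumes "z2_red u = z2_red v"
  shows "z2_red (rev u) = z2_red (rev v)"
proof -
  have "z2_red (rev (u @ [a, a] @ v)) = z2_red (rev (u @ v))" for u a v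
    using z2.red_cancel[of "rev v" a "rev u"] by (simp add: z2_red_eq)
  then have "z2_red (rev (z2_red w)) = z2_red (rev w)" for w
    unfolding z2_red_eq by (rule z2.red_invariant)
  with assms show ?thesis by metis
qed

section \<open>From letter-invariant sets to S-invariant subgroups\<close>

context letter_invariant
begin

lemma expand_fg_red: "expand (fg_red w) \<in> K \<longleftrightarrow> expand w \<in> K"
proof -
  have "expand (u @ [a, flip a] @ v) \<in> K \<longleftrightarrow> expand (u @ v) \<in> K" for u a v
  proof (cases a)
    case (Pair b k)
    then show ?thesis
      using cancel_iff[of "expand u @ [k]" 0 "[k] @ expand v"] cancel_iff[of "expand u" k "expand v"]
        cancel_iff[of "expand u @ [0]" k "[0] @ expand v"] cancel_iff[of "expand u" 0 "expand v"]
      by simp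
  qed
  then show ?thesis unfolding fg_red_eq by (rule fg.red_invariant)
qed

text \<open>Since x_k expands to \<open>[0, k]\<close>, the letter map \<open>f\<close> induces the
  endomorphism sending x_k to the element of \<open>[f 0, f k]\<close>. The generators (i), (ii) and
  (iii) of \<open>S_semigroup\<close> are of this form.\<close>

lemma fg_endo_mem:
  assumes g: "\<And>k. 0 < k \<Longrightarrow> positive (g k) \<and> z2_red (expand (g k)) = z2_red [f 0, f k]"
    and w: "w \<in> subgroup_of_words K"
  shows "fg_endo g w \<in> subgroup_of_words K"
proof -
  from w have pos: "positive w" and wK: "expand w \<in> K"
    by (auto simp: subgroup_of_words_def carrier_free_grp)
  have "z2_red (expand (fg_subst g w)) = z2_red (map f (expand w))"
    using pos
  proof (induction w)
    case (Cons x w)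
    obtain b k where x: "x = (b, k)" by (cases x)
    with Cons.prems have "0 < k" by simp
    with g have gk: "z2_red (expand (g k)) = z2_red [f 0, f k]" by blast
    from z2_red_rev_cong[OF this] have gk': "z2_red (expand (fg_inv (g k))) = z2_red [f k, f 0]"
      by (simp add: expand_fg_inv)
    have "z2_red (expand (fg_subst g [x])) = z2_red (map f (expand [x]))"
      using gk gk' by (simp add: x)
    with Cons show ?case
      using z2.red_append_cong[of "expand (fg_subst g [x])" "map f (expand [x])"
          "expand (fg_subst g w)" "map f (expand w)"]
      by (simp add: z2_red_eq)
  qed simp
  from z2_red_cong[OF this] map_closed[OF wK, of f]
  have "expand (fg_subst g w) \<in> K" by simp
  moreover have "positive (fg_subst g w)"
    using g pos by (intro positive_fg_subst) auto
  ultimately show ?thesis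
    by (simp add: subgroup_of_words_def fg_endo_def expand_fg_red fg_red_carrier)
qed

lemma subgroup_subgroup_of_words: "subgroup (subgroup_of_words K) free_grp"
proof
  show "subgroup_of_words K \<subseteq> carrier free_grp" by (auto simp: subgroup_of_words_def)
  show "\<one>\<^bsub>free_grp\<^esub> \<in> subgroup_of_words K"
    by (simp add: subgroup_of_words_def carrier_free_grp Nil_mem)
next
  fix x y assume "x \<in> subgroup_of_words K" "y \<in> subgroup_of_words K"
  then show "x \<otimes>\<^bsub>free_grp\<^esub> y \<in> subgroup_of_words K"
    by (simp add: subgroup_of_words_def expand_fg_red append_closed fg_red_append_carrier)
next
  fix x assume x: "x \<in> subgroup_of_words K"
  then have "positive x" "expand x \<in> K" by (auto simp: subgroup_of_words_def carrier_free_grp)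
  with x show "inv\<^bsub>free_grp\<^esub> x \<in> subgroup_of_words K"
    by (simp add: subgroup_of_words_def expand_fg_red expand_fg_inv rev_closed inv_free_grp
        fg_red_carrier)
qed

lemma S_invariant_subgroup_of_words: "S_invariant (subgroup_of_words K)"
proof -
  have "\<phi> w \<in> subgroup_of_words K" if "\<phi> \<in> S_semigroup" "w \<in> subgroup_of_words K" for \<phi> w
    using that
  proof (induction arbitrary: w)
    case (gen_i n idx)
    then show ?case
      by (intro fg_endo_mem[where f="\<lambda>k. if 1 \<le> k \<and> k \<le> n then idx k else k"]) (auto simp: Suc_le_eq)
  next
    \<comment> \<open>Renaming the base letter 0 as \<open>i\<close> turns \<open>[0, k]\<close>
      into \<open>[i, k]\<close>, which is x_i^-1 x_k.\<close>
    case (gen_ii i)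
    then show ?case
      by (intro fg_endo_mem[where f="\<lambda>k. if k = 0 then i else k"]) (auto simp: fg_red_def z2_red_def)
  next
    case (gen_iii k)
    then show ?case
      by (intro fg_endo_mem[where f="\<lambda>j. if j = k then 0 else j"]) (auto simp: z2_red_def)
  next
    case gen_iv
    then have w: "positive w" "expand w \<in> K" by (auto simp: subgroup_of_words_def carrier_free_grp)
    let ?g = "\<lambda>k::nat. [(True, k)]"
    \<comment> \<open>Inverting all generators is conjugation by the letter 0, an element of G
      outside E: \<open>[0] @ [0, k] @ [0]\<close> reduces to \<open>[k, 0]\<close>.\<close>
    have "z2_red (expand (fg_subst ?g w)) = z2_red ([0] @ expand w @ [0])" using w(1)
    proof (induction w)
      case Nil
      show ?case by (simp add: z2_red_def)
    next
      case (Cons x w)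
      have eq: "z2_red (expand (fg_subst ?g [x])) = z2_red ([0] @ expand [x] @ [0])"
        by (auto simp: z2_red_def fg_inv_def split: prod.splits)
      have "z2_red (expand (fg_subst ?g (x # w)))
          = z2_red (([0] @ expand [x]) @ [0, 0] @ (expand w @ [0]))"
        using z2.red_append_cong[OF eq[unfolded z2_red_eq]] Cons by (simp add: z2_red_eq)
      also have "\<dots> = z2_red (([0] @ expand [x]) @ (expand w @ [0]))"
        unfolding z2_red_eq by (rule z2.red_cancel)
      finally show ?case by simp
    qed
    from z2_red_cong[OF this] have "expand (fg_subst ?g w) \<in> K"
      using conjugate_iff[of "[0]"] w(2) by simp
    moreover have "positive (fg_subst ?g w)" using w(1) by (intro positive_fg_subst) auto
    ultimately show ?case
      by (simp add: subgroup_of_words_def fg_endo_def expand_fg_red fg_red_carrier)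
  next
    case (gen_v u)
    then have "positive (u @ w @ fg_inv u)" "expand w \<in> K"
      by (auto simp: subgroup_of_words_def carrier_free_grp fg_inv_def)
    then show ?case
      by (simp add: subgroup_of_words_def expand_fg_red fg_red_carrier expand_fg_inv conjugate_iff)
  next
    case (compose \<phi> \<psi>)
    then show ?case by simp
  qed
  then show ?thesis by (auto simp: S_invariant_def)
qed

lemma words_of_subgroup_of_words:
  assumes "[0, 1] \<notin> K"
  shows "words_of_subgroup (subgroup_of_words K) = K"
proof -
  have "w \<in> words_of_subgroup (subgroup_of_words K) \<longleftrightarrow> even (length w) \<and> w \<in> K" for w
    using z2_red_cong[OF z2_red_expand_compress[of w]]
    by (auto simp: words_of_subgroup_def subgroup_of_words_def expand_fg_red
        fg_red_carrier positive_compress)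
  with even_length[OF assms] show ?thesis by blast
qed

end

text \<open>Endomorphisms sending generators to generators or to the identity act on words as letter
  maps; \<open>h 0 = 0\<close> guarantees that letters omitted by \<open>compress\<close> remain
  omitted.\<close>

lemma fg_subst_compress:
  assumes "\<And>a. a \<in> set w \<Longrightarrow> a \<noteq> 0 \<Longrightarrow> g a = (if h a = 0 then [] else [(False, h a)])" "h 0 = 0"
  shows "fg_subst g (compress s w) = compress s (map h w)"
  using assms(1)
proof (induction w arbitrary: s)
  case (Cons a w)
  then show ?case using assms(2) by (auto simp: fg_inv_def)
qed simp

section \<open>Invariant subgroups\<close>

locale S_invariant_subgroup =
  fixes H :: "(bool \<times> nat) list set"
  assumes subgroup: "subgroup H free_grp"
    and S_invariant: "S_invariant H"
begin

lemma H_carrier: "x \<in> H \<Longrightarrow> x \<in> carrier free_grp"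
  using subgroup by (auto dest: subgroup.subset)

lemma S_mem: "\<phi> \<in> S_semigroup \<Longrightarrow> x \<in> H \<Longrightarrow> \<phi> x \<in> H"
  using S_invariant by (auto simp: S_invariant_def)

lemma endo_mem:
  assumes "fg_endo g \<in> S_semigroup" "fg_red w \<in> H"
  shows "fg_red (fg_subst g w) \<in> H"
  using S_mem[OF assms] unfolding fg_endo_fg_red unfolding fg_endo_def .

lemma fg_red_append_mem: "fg_red u \<in> H \<Longrightarrow> fg_red v \<in> H \<Longrightarrow> fg_red (u @ v) \<in> H"
  using subgroup.m_closed[OF subgroup, of "fg_red u" "fg_red v"]
  by (simp add: fg_red_eq fg.red_append_red fg.red_red_append)

lemma fg_red_inv_mem:
  assumes "fg_red w \<in> H"
  shows "fg_red (fg_inv w) \<in> H"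
  using subgroup.m_inv_closed[OF subgroup assms]
  by (simp add: inv_free_grp[OF H_carrier[OF assms]] fg_inv_fg_red)

lemma fg_red_conj_mem:
  assumes "u \<in> carrier free_grp" "fg_red w \<in> H"
  shows "fg_red (u @ w @ fg_inv u) \<in> H"
  using S_mem[OF S_semigroup.gen_v[OF assms(1)] assms(2)] by (simp add: fg_red_eq fg.red_red_mid)

lemma fg_red_flip_mem: "fg_red w \<in> H \<Longrightarrow> fg_red (map flip w) \<in> H"
proof -
  have "fg_subst (\<lambda>k. [(True, k)]) w = map flip w" by (induction w) (auto simp: fg_inv_def)
  then show "fg_red w \<in> H \<Longrightarrow> fg_red (map flip w) \<in> H"
    using endo_mem[OF S_semigroup.gen_iv, of w] by simp
qed

text \<open>Conjugation moves the contribution of the first letter to the end. Every position has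
  then changed parity, and the generator (iv) corrects all signs at once.\<close>

lemma rotate1_mem:
  assumes "a # w \<in> words_of_subgroup H"
  shows "w @ [a] \<in> words_of_subgroup H"
proof -
  define c where "c = (if a = 0 then [] else [(True, a)])"
  have c: "fg_inv (fg_inv c) = c" "fg_inv c \<in> carrier free_grp"
    by (auto simp: c_def fg_inv_def carrier_free_grp)
  let ?z = "compress False w"
  from assms have odd: "odd (length w)" and "fg_red (c @ ?z) \<in> H"
    by (auto simp: words_of_subgroup_def c_def)
  from fg_red_conj_mem[OF c(2) this(2)] c(1)
  have "fg_red ((fg_inv c @ c) @ (?z @ c)) \<in> H" by simp
  moreover have "fg_red ((fg_inv c @ c) @ (?z @ c)) = fg_red ([] @ (?z @ c))"
    unfolding fg_red_eq
    by (rule fg.red_append_cong) (simp_all add: fg_inv_eq fg.red_inverse_left)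
  ultimately have "fg_red (?z @ c) \<in> H" by simp
  from fg_red_flip_mem[OF this] have "fg_red (compress True w @ map flip c) \<in> H"
    using compress_Not[of False w] by simp
  also have "compress True w @ map flip c = compress True (w @ [a])"
    using odd by (simp add: compress_append c_def)
  finally show ?thesis using odd by (simp add: words_of_subgroup_def)
qed

lemma map_mem_fixing_zero:
  assumes "w \<in> words_of_subgroup H" "g 0 = 0"
  shows "map g w \<in> words_of_subgroup H"
proof -
  \<comment> \<open>A generator of type (i) acts on finitely many x_k only, so \<open>n\<close> has
    to bound the letters of \<open>w\<close>; \<open>N\<close> bounds their images.\<close>
  obtain n where n: "\<And>a. a \<in> set w \<Longrightarrow> a < n"
    using finite_nat_set_iff_bounded[of "set w"] by auto
  obtain N where N: "\<And>a. a \<in> set w \<Longrightarrow> g a < N"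
    using finite_nat_set_iff_bounded[of "g ` set w"] by auto
  \<comment> \<open>Generators of type (i) cannot send a letter to 0, so letters going to 0 take a detour
    through the fresh letter \<open>N + 1\<close>, which type (iii) then kills.\<close>
  define idx where "idx k = (if k = 0 then 0 else if g k = 0 then Suc N else g k)" for k
  define h where "h k = (if k = Suc N then 0 else k)" for k
  let ?g1 = "\<lambda>k. if 1 \<le> k \<and> k \<le> n then [(False, idx k)] else [(False, k)]"
  let ?g2 = "\<lambda>k. if k = Suc N then [] else [(False, k)]"
  have "fg_endo ?g1 \<in> S_semigroup" by (rule S_semigroup.gen_i) (auto simp: idx_def)
  moreover have "fg_subst ?g1 (compress True w) = compress True (map idx w)"
  proof (rule fg_subst_compress)
    fix a assume "a \<in> set w" "a \<noteq> 0"
    with n[of a] show "?g1 a = (if idx a = 0 then [] else [(False, idx a)])"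
      by (auto simp: idx_def)
  qed (simp add: idx_def)
  ultimately have "fg_red (compress True (map idx w)) \<in> H"
    using endo_mem[of ?g1 "compress True w"] assms(1) by (simp add: words_of_subgroup_def)
  moreover have "fg_endo ?g2 \<in> S_semigroup" by (rule S_semigroup.gen_iii) simp
  moreover have "fg_subst ?g2 (compress True (map idx w)) = compress True (map h (map idx w))"
    by (rule fg_subst_compress) (auto simp: h_def)
  moreover have "map h (map idx w) = map g w"
    using N assms(2) by (fastforce simp: h_def idx_def)
  ultimately have "fg_red (compress True (map g w)) \<in> H"
    using endo_mem[of ?g2 "compress True (map idx w)"] by metis
  then show ?thesis using assms(1) by (simp add: words_of_subgroup_def)
qed

text \<open>The generator (ii) replaces the base letter: x_p^-1 x_q is unchanged for nonzero
  \<open>p\<close> and \<open>q\<close> because the inserted x_M and x_M^-1 cancel, and if exactly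
  one of the two letters is 0, a factor x_M or x_M^-1 appears in its place.\<close>

lemma map_mem_moving_zero:
  assumes "w \<in> words_of_subgroup H" "1 \<le> M"
  shows "map (subst1 0 M) w \<in> words_of_subgroup H"
proof -
  let ?g = "\<lambda>k. fg_red [(True, M), (False, k)]"
  have "even (length w) \<Longrightarrow>
      fg_red (fg_subst ?g (compress True w)) = fg_red (compress True (map (subst1 0 M) w))" for w
  proof (induction w rule: induct_list012)
    case (3 x y w)
    then have IH: "fg_red (fg_subst ?g (compress True w)) = fg_red (compress True (map (subst1 0 M) w))"
      by simp
    have "fg_red (fg_subst ?g (compress True [x, y])) = fg_red (compress True (map (subst1 0 M) [x, y]))"
      using assms(2) by (auto simp: fg_red_def fg_inv_def subst1_def)
    then show ?case
      using fg.red_append_cong[of "fg_subst ?g (compress True [x, y])"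
          "compress True (map (subst1 0 M) [x, y])" "fg_subst ?g (compress True w)"
          "compress True (map (subst1 0 M) w)"]
        IH compress_append[of True "[x, y]" w]
        compress_append[of True "map (subst1 0 M) [x, y]" "map (subst1 0 M) w"]
      by (simp add: fg_red_eq)
  qed simp_all
  moreover from assms(1) have "even (length w)" "fg_red (compress True w) \<in> H"
    by (auto simp: words_of_subgroup_def)
  ultimately show ?thesis
    using endo_mem[OF S_semigroup.gen_ii[OF assms(2)], of "compress True w"]
    by (simp add: words_of_subgroup_def)
qed

lemma map_mem:
  assumes "w \<in> words_of_subgroup H"
  shows "map f w \<in> words_of_subgroup H"
proof -
  \<comment> \<open>Moving the letter 0 away to a fresh \<open>M\<close> first reduces to a map that fixes 0.\<close>
  obtain M where M: "M \<notin> set w" "M \<noteq> 0" using ex_fresh by blast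
  define g where "g a = (if a = 0 then 0 else if a = M then f 0 else f a)" for a
  from assms M have "map (subst1 0 M) w \<in> words_of_subgroup H"
    by (intro map_mem_moving_zero) auto
  from map_mem_fixing_zero[OF this, of g]
  have "map g (map (subst1 0 M) w) \<in> words_of_subgroup H" by (simp add: g_def)
  also have "map g (map (subst1 0 M) w) = map f w"
    using M by (auto simp: g_def subst1_def)
  finally show ?thesis .
qed

lemma letter_invariant_words_of_subgroup: "letter_invariant (words_of_subgroup H)"
proof
  fix w f assume "w \<in> words_of_subgroup H"
  then show "map f w \<in> words_of_subgroup H" by (rule map_mem)
next
  fix u v assume "u \<in> words_of_subgroup H" "v \<in> words_of_subgroup H"
  then show "u @ v \<in> words_of_subgroup H"
    by (simp add: words_of_subgroup_def compress_append fg_red_append_mem)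
next
  fix w assume "w \<in> words_of_subgroup H"
  then show "rev w \<in> words_of_subgroup H"
    using fg_red_inv_mem[of "compress True w"] compress_Not[of True w]
    by (simp add: words_of_subgroup_def compress_rev fg_inv_eq)
next
  fix u v assume "u @ v \<in> words_of_subgroup H"
  then show "v @ u \<in> words_of_subgroup H"
  proof (induction u arbitrary: v)
    case (Cons a u)
    then show ?case using rotate1_mem[of a "u @ v"] Cons.IH[of "v @ [a]"] by simp
  qed simp
next
  fix u a v
  show "u @ [a, a] @ v \<in> words_of_subgroup H \<longleftrightarrow> u @ v \<in> words_of_subgroup H"
    unfolding words_of_subgroup_def mem_Collect_eq fg_red_compress_cancel by simp
next
  show "[] \<in> words_of_subgroup H"
    using subgroup.one_closed[OF subgroup] by (simp add: words_of_subgroup_def fg_red_def)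
qed

lemma subgroup_of_words_of_subgroup: "subgroup_of_words (words_of_subgroup H) = H"
proof -
  have "compress True (expand x) = x" if "x \<in> carrier free_grp" for x
    using that by (intro compress_expand) (simp add: carrier_free_grp)
  then have "expand x \<in> words_of_subgroup H \<longleftrightarrow> x \<in> H" if "x \<in> carrier free_grp" for x
    using that by (simp add: words_of_subgroup_def even_length_expand fg_red_id)
  with H_carrier show ?thesis by (auto simp: subgroup_of_words_def)
qed

text \<open>The word \<open>[0, 1]\<close> is x_1, and generators of type (i) send x_1 to every x_k.
  Thus excluding the double singleton corresponds to properness of the subgroup.\<close>

lemma eq_carrier_iff: "H = carrier free_grp \<longleftrightarrow> [0, 1] \<in> words_of_subgroup H"
proof -
  have "[0, 1] \<in> words_of_subgroup H \<longleftrightarrow> [(False, 1)] \<in> H"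
    by (simp add: words_of_subgroup_def fg_red_def)
  also have "\<dots> \<longleftrightarrow> H = carrier free_grp"
  proof
    assume x1: "[(False, 1)] \<in> H"
    have gen: "[(False, k)] \<in> H" if "0 < k" for k
      using S_mem[OF S_semigroup.gen_i[of 1 "\<lambda>_. k"] x1] that by (simp add: fg_endo_def fg_red_def)
    have letter: "fg_red [x] \<in> H" if "0 < snd x" for x
      using gen[of "snd x"] fg_red_inv_mem[of "[(False, snd x)]"] that
      by (cases x; cases "fst x") (auto simp: fg_red_def fg_inv_def)
    have "positive w \<Longrightarrow> fg_red w \<in> H" for w
    proof (induction w)
      case Nil
      then show ?case using subgroup.one_closed[OF subgroup] by (simp add: fg_red_def)
    next
      case (Cons x w)
      then show ?case using fg_red_append_mem[OF letter, of x w] by simp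
    qed
    then have "w \<in> H" if "w \<in> carrier free_grp" for w
      using that fg_red_id[OF that] by (metis carrier_free_grp)
    with H_carrier show "H = carrier free_grp" by blast
  qed (simp add: carrier_free_grp)
  finally show ?thesis by blast
qed

end

section \<open>Assembling the isomorphism\<close>

lemma F_free_eq:
  assumes "simpl_hyperoctahedral C"
  shows "F_free C = subgroup_of_words (words_of C)"
proof -
  interpret partition_category C
    using assms by unfold_locales (simp add: simpl_hyperoctahedral_def hyperoctahedral_def)
  interpret letter_invariant "words_of C"
    using assms by (rule words_of_simpl_hyperoctahedral)
  have "iota x \<in> F_of C \<longleftrightarrow> expand x \<in> words_of C" for x
  proof
    assume "iota x \<in> F_of C"
    then obtain w where w: "w \<in> words_of C" "z2_red (map Suc (expand x)) = z2_red (map Suc w)"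
      by (auto simp: F_of_eq iota_eq)
    from z2_red_cong[OF w(2)] w(1) show "expand x \<in> words_of C" by (simp add: inj_map_iff)
  qed (auto simp: F_of_eq iota_eq)
  then show ?thesis by (simp add: F_free_def subgroup_of_words_def)
qed

lemma F_of_subset_E:
  assumes "simpl_hyperoctahedral C"
  shows "F_of C \<subseteq> E_carrier"
proof -
  interpret partition_category C
    using assms by unfold_locales (simp add: simpl_hyperoctahedral_def hyperoctahedral_def)
  interpret letter_invariant "words_of C"
    using assms by (rule words_of_simpl_hyperoctahedral)
  have "z2_red (map Suc w) \<in> E_carrier" if "w \<in> words_of C" for w
    using even_length[OF words_of_simpl_hyperoctahedral(2)[OF assms] that]
      z2.reduced_red[of "map Suc w"] z2.set_red[of "map Suc w"] z2.even_length_red[of "map Suc w"]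
    by (auto simp: E_carrier_def G_carrier_def z2_reduced_iff z2_red_eq)
  then show ?thesis by (auto simp: F_of_eq)
qed

lemma parts_of_F_free:
  assumes "simpl_hyperoctahedral C"
  shows "parts_of (words_of_subgroup (F_free C)) = C"
proof -
  interpret partition_category C
    using assms by unfold_locales (simp add: simpl_hyperoctahedral_def hyperoctahedral_def)
  interpret letter_invariant "words_of C"
    using assms by (rule words_of_simpl_hyperoctahedral)
  show ?thesis
    using words_of_subgroup_of_words[OF words_of_simpl_hyperoctahedral(2)[OF assms]]
    by (simp add: F_free_eq[OF assms] parts_of_words_of)
qed

theorem mainTheorem10:
  shows "(\<forall>C. simpl_hyperoctahedral C \<longrightarrow> F_of C \<subseteq> E_carrier) \<and>
         bij_betw F_free {C. simpl_hyperoctahedral C}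
           {H. subgroup H free_grp \<and> H \<noteq> carrier free_grp \<and> S_invariant H} \<and>
         (\<forall>C D. simpl_hyperoctahedral C \<longrightarrow> simpl_hyperoctahedral D \<longrightarrow>
            (C \<subseteq> D \<longleftrightarrow> F_free C \<subseteq> F_free D))"
proof (intro conjI allI impI)
  fix C assume "simpl_hyperoctahedral C"
  then show "F_of C \<subseteq> E_carrier" by (rule F_of_subset_E)
next
  let ?Cs = "{C. simpl_hyperoctahedral C}"
  let ?Hs = "{H. subgroup H free_grp \<and> H \<noteq> carrier free_grp \<and> S_invariant H}"
  \<comment> \<open>The inverse map: all partitions whose words represent elements of
    \<open>H\<close>.\<close>
  let ?\<Psi> = "\<lambda>H. parts_of (words_of_subgroup H)"
  have to: "F_free C \<in> ?Hs" if C: "simpl_hyperoctahedral C" for C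
  proof -
    interpret letter_invariant "words_of C"
      using C by (rule words_of_simpl_hyperoctahedral)
    note W = words_of_simpl_hyperoctahedral(2)[OF C]
    interpret S_invariant_subgroup "F_free C"
      unfolding F_free_eq[OF C]
      by (rule S_invariant_subgroup.intro[OF subgroup_subgroup_of_words S_invariant_subgroup_of_words])
    have "F_free C \<noteq> carrier free_grp"
      unfolding eq_carrier_iff using W words_of_subgroup_of_words[OF W] by (simp add: F_free_eq[OF C])
    with subgroup S_invariant show ?thesis by simp
  qed
  have from_H: "simpl_hyperoctahedral (?\<Psi> H) \<and> F_free (?\<Psi> H) = H" if H: "H \<in> ?Hs" for H
  proof -
    interpret S_invariant_subgroup H using H by (auto intro: S_invariant_subgroup.intro)
    interpret letter_invariant "words_of_subgroup H" by (rule letter_invariant_words_of_subgroup)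
    have simpl: "simpl_hyperoctahedral (?\<Psi> H)"
      using H eq_carrier_iff by (intro simpl_hyperoctahedral_parts_of) auto
    then show ?thesis
      by (simp add: F_free_eq words_of_parts_of subgroup_of_words_of_subgroup)
  qed
  show "bij_betw F_free ?Cs ?Hs"
    by (rule bij_betw_byWitness[where f'="?\<Psi>"]) (use to from_H parts_of_F_free in auto)
next
  fix C D assume C: "simpl_hyperoctahedral C" and D: "simpl_hyperoctahedral D"
  show "C \<subseteq> D \<longleftrightarrow> F_free C \<subseteq> F_free D"
  proof
    assume "C \<subseteq> D"
    then show "F_free C \<subseteq> F_free D"
      by (auto simp: F_free_eq[OF C] F_free_eq[OF D] subgroup_of_words_def words_of_def)
  next
    assume "F_free C \<subseteq> F_free D"
    \<comment> \<open>The inverse map is monotone as well, so inclusion is reflected.\<close>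
    then have "parts_of (words_of_subgroup (F_free C)) \<subseteq> parts_of (words_of_subgroup (F_free D))"
      by (auto simp: parts_of_def words_of_subgroup_def)
    then show "C \<subseteq> D" by (simp add: parts_of_F_free C D)
  qed
qed

end
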